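(* Let $p$ be a prime and let $G$ be a finite $p$-group such that the Chermak-Delgado lattice $\mathcal{CD}(G)$ is a quasi-antichain of width $w$ and such that $G$ has properties (P1), (P2) and (P3). Let $t$ be the number of atoms of $\mathcal{CD}(G)$ that are abelian groups, and suppose that $t>2$. Then there are positive integers $a$ and $b$ such that $w=p^a+1$ and $t=p^b+1$, where $a=b$ or $a=2b$. Moreover, if $|G/Z(G)|=p^{2n}$, then $a\mid n$.
   Context: For a finite group $G$ and $H\le G$, the Chermak-Delgado measure of $H$ in $G$ is $m_G(H)=|H|\,|C_G(H)|$. Put $m^*(G)=\max\{m_G(H)\mid H\le G\}$ and $\mathcal{CD}(G)=\{H\le G\mid m_G(H)=m^*(G)\}$. It is known that $\mathcal{CD}(G)$, ordered by inclusion, is a lattice of subgroups of $G$, called the Chermak-Delgado lattice of $G$. A quasi-antichain is a lattice consisting of a maximum, a minimum, and the atoms of the lattice; its width $w$ is the number of atoms, and $w\ge 3$ is assumed. Let $M_1,\dots,M_w$ be all the atoms of $\mathcal{CD}(G)$. Properties (P1)-(P3) are: (P1) Both $G/Z(G)$ and $G'$ are elementary abelian. (P2) $M_i/Z(G)\cong M_j/Z(G)$ and $G/Z(G)=M_i/Z(G)\times M_j/Z(G)$ for $i\ne j$. (P3) Let $M_1=\langle x_1,\dots,x_n\rangle Z(G)$ and $M_2=\langle y_1,\dots,y_n\rangle Z(G)$, where $M_1/Z(G)$ and $M_2/Z(G)$ are elementary abelian of order $p^n$. Then for each $k\ge 3$ one has $M_k=\langle x_1y_1',\dots,x_ny_n'\rangle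 Z(G)$ for some $y_1',\dots,y_n'$ with $M_2=\langle y_1',\dots,y_n'\rangle Z(G)$; moreover there is an invertible $n\times n$ matrix $(c^{(k)}_{ij})$ over $\mathbb{F}_p$ with $y_j'\equiv\prod_{i=1}^n y_i^{c^{(k)}_{ij}} \pmod{Z(G)}$ for $j=1,\dots,n$. *)

theory Defs
  imports "HOL-Algebra.Algebra" "HOL-Number_Theory.Residues"
begin

definition centralizer :: "('a, 'm) monoid_scheme \<Rightarrow> 'a set \<Rightarrow> 'a set" where
  "centralizer G H = {g \<in> carrier G. \<forall>h\<in>H. g \<otimes>\<^bsub>G\<^esub> h = h \<otimes>\<^bsub>G\<^esub> g}"

definition center :: "('a, 'm) monoid_scheme \<Rightarrow> 'a set" where
  "center G = centralizer G (carrier G)"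

definition finite_p_group :: "nat \<Rightarrow> ('a, 'm) monoid_scheme \<Rightarrow> bool" where
  "finite_p_group p G \<longleftrightarrow> group G \<and> finite (carrier G) \<and> (\<exists>k. order G = p ^ k)"

definition elementary_abelian :: "nat \<Rightarrow> ('a, 'm) monoid_scheme \<Rightarrow> bool" where
  "elementary_abelian p G \<longleftrightarrow> comm_group G \<and> (\<forall>g\<in>carrier G. g [^]\<^bsub>G\<^esub> p = \<one>\<^bsub>G\<^esub>)"

definition cd_measure :: "('a, 'm) monoid_scheme \<Rightarrow> 'a set \<Rightarrow> nat" where
  "cd_measure G H = card H * card (centralizer G H)"

definition cd_max :: "('a, 'm) monoid_scheme \<Rightarrow> nat" where
  "cd_max G = Max {cd_measure G H | H. subgroup H G}"

definition cd_lattice :: "('a, 'm) monoid_scheme \<Rightarrow> 'a set gorder" where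
  "cd_lattice G =
     \<lparr>carrier = {H. subgroup H G \<and> cd_measure G H = cd_max G}, eq = (=), le = (\<subseteq>)\<rparr>"

definition atoms :: "('a, 'm) gorder_scheme \<Rightarrow> 'a set" where
  "atoms L = {x \<in> carrier L. \<bottom>\<^bsub>L\<^esub> \<sqsubset>\<^bsub>L\<^esub> x \<and>
     \<not> (\<exists>y\<in>carrier L. \<bottom>\<^bsub>L\<^esub> \<sqsubset>\<^bsub>L\<^esub> y \<and> y \<sqsubset>\<^bsub>L\<^esub> x)}"

definition quasi_antichain :: "('a, 'm) gorder_scheme \<Rightarrow> nat \<Rightarrow> bool" where
  "quasi_antichain L w \<longleftrightarrow>
     bounded_lattice L \<and> carrier L = {\<top>\<^bsub>L\<^esub>, \<bottom>\<^bsub>L\<^esub>} \<union> atoms L \<and>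
     card (atoms L) = w \<and> w \<ge> 3"

definition mod_center :: "('a, 'm) monoid_scheme \<Rightarrow> 'a set \<Rightarrow> 'a set monoid" where
  "mod_center G M = (G\<lparr>carrier := M\<rparr>) Mod (center G)"

definition internal_direct_product ::
    "('a, 'm) monoid_scheme \<Rightarrow> 'a set \<Rightarrow> 'a set \<Rightarrow> bool" where
  "internal_direct_product G A B \<longleftrightarrow>
     A \<lhd> G \<and> B \<lhd> G \<and> A \<inter> B = {\<one>\<^bsub>G\<^esub>} \<and> A <#>\<^bsub>G\<^esub> B = carrier G"

text \<open>An \<open>n \<times> n\<close> matrix is a function on indices, of which only the values on
  \<open>{1..n} \<times> {1..n}\<close> matter.\<close>

definition matrix_inverse ::
    "('a, 'm) ring_scheme \<Rightarrow> nat \<Rightarrow> (nat \<Rightarrow> nat \<Rightarrow> 'a) \<Rightarrow> (nat \<Rightarrow> nat \<Rightarrow> 'a) \<Rightarrow> bool" where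
  "matrix_inverse R n c d \<longleftrightarrow>
     (\<forall>i\<in>{1..n}. \<forall>j\<in>{1..n}.
        (\<Oplus>\<^bsub>R\<^esub>l\<in>{1..n}. c i l \<otimes>\<^bsub>R\<^esub> d l j) = (if i = j then \<one>\<^bsub>R\<^esub> else \<zero>\<^bsub>R\<^esub>) \<and>
        (\<Oplus>\<^bsub>R\<^esub>l\<in>{1..n}. d i l \<otimes>\<^bsub>R\<^esub> c l j) = (if i = j then \<one>\<^bsub>R\<^esub> else \<zero>\<^bsub>R\<^esub>))"

definition invertible_matrix :: "('a, 'm) ring_scheme \<Rightarrow> nat \<Rightarrow> (nat \<Rightarrow> nat \<Rightarrow> 'a) \<Rightarrow> bool" where
  "invertible_matrix R n c \<longleftrightarrow>
     (\<forall>i\<in>{1..n}. \<forall>j\<in>{1..n}. c i j \<in> carrier R) \<and>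
     (\<exists>d. (\<forall>i\<in>{1..n}. \<forall>j\<in>{1..n}. d i j \<in> carrier R) \<and> matrix_inverse R n c d)"

definition P1 :: "nat \<Rightarrow> ('a, 'm) monoid_scheme \<Rightarrow> bool" where
  "P1 p G \<longleftrightarrow>
     elementary_abelian p (G Mod center G) \<and>
     elementary_abelian p (G\<lparr>carrier := derived G (carrier G)\<rparr>)"

definition P2 :: "('a, 'm) monoid_scheme \<Rightarrow> nat \<Rightarrow> (nat \<Rightarrow> 'a set) \<Rightarrow> bool" where
  "P2 G w M \<longleftrightarrow>
     (\<forall>i\<in>{1..w}. \<forall>j\<in>{1..w}. i \<noteq> j \<longrightarrow>
        mod_center G (M i) \<cong> mod_center G (M j) \<and>
        internal_direct_product (G Mod center G)
          (carrier (mod_center G (M i))) (carrier (mod_center G (M j))))"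

text \<open>The predicate \<open>generates_mod_center G n x M\<close> expresses
  \<open>M = \<langle>x\<^sub>1, \<dots>, x\<^sub>n\<rangle> Z(G)\<close>.\<close>

definition generates_mod_center ::
    "('a, 'm) monoid_scheme \<Rightarrow> nat \<Rightarrow> (nat \<Rightarrow> 'a) \<Rightarrow> 'a set \<Rightarrow> bool" where
  "generates_mod_center G n x M \<longleftrightarrow>
     x \<in> {1..n} \<rightarrow> carrier G \<and> M = generate G (x ` {1..n}) <#>\<^bsub>G\<^esub> center G"

text \<open>The field \<open>\<F>\<^sub>p\<close> is \<^term>\<open>residue_ring (int p)\<close>, whose elements are the integers
  \<open>0, \<dots>, p - 1\<close>, so its elements can be used directly as exponents. Congruence modulo
  \<open>Z(G)\<close> is equality of cosets, and the product is taken in \<open>G/Z(G)\<close>, which is commutative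
  by \<open>P1\<close>, so no order of factors has to be chosen.\<close>

definition P3 :: "nat \<Rightarrow> ('a, 'm) monoid_scheme \<Rightarrow> nat \<Rightarrow> (nat \<Rightarrow> 'a set) \<Rightarrow> bool" where
  "P3 p G w M \<longleftrightarrow>
     (\<forall>n x y.
        elementary_abelian p (mod_center G (M 1)) \<and> order (mod_center G (M 1)) = p ^ n \<and>
        elementary_abelian p (mod_center G (M 2)) \<and> order (mod_center G (M 2)) = p ^ n \<and>
        generates_mod_center G n x (M 1) \<and> generates_mod_center G n y (M 2) \<longrightarrow>
        (\<forall>k\<in>{3..w}. \<exists>y'.
           generates_mod_center G n y' (M 2) \<and>
           generates_mod_center G n (\<lambda>j. x j \<otimes>\<^bsub>G\<^esub> y' j) (M k) \<and>
           (\<exists>c. invertible_matrix (residue_ring (int p)) n c \<and>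
              (\<forall>j\<in>{1..n}. center G #>\<^bsub>G\<^esub> y' j =
                 (\<Otimes>\<^bsub>G Mod center G\<^esub>i\<in>{1..n}.
                    (center G #>\<^bsub>G\<^esub> y i) [^]\<^bsub>G Mod center G\<^esub> c i j)))))"

end

theory Submission
  imports Defs "HOL-Computational_Algebra.Polynomial_Factorial"
    "HOL-Computational_Algebra.Fundamental_Theorem_Algebra"
begin

text \<open>Write \<open>V = G/Z(G)\<close>, with the alternating commutator form \<open>\<kappa>\<close>. Two distinct atoms meet in \<open>Z(G)\<close>, so
  the maximal measure is \<open>|Z(G)| |G|\<close>, and the atoms correspond to the proper nontrivial subgroups
  \<open>U\<close> of \<open>V\<close> with \<open>|U| |perp U| = |V|\<close>; abelian atoms correspond to isotropic \<open>U\<close>.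
  Fix three isotropic atoms \<open>A, B, C\<close> in \<open>V\<close>. As \<open>V = A \<times> B\<close> and \<open>C\<close> is the graph of an isomorphism
  \<open>\<phi>: A \<rightarrow> B\<close>, the pairing \<open>g u x = \<kappa> u (\<phi> x)\<close> on \<open>A\<close> is symmetric. Every atom other than \<open>B\<close> is the graph
  of \<open>\<phi> \<circ> f\<close> for an endomorphism \<open>f\<close> of \<open>A\<close>, and \<open>perp\<close> of that graph is the graph belonging to the
  \<open>g\<close>-adjoint of \<open>f\<close>. Thus the atoms other than \<open>B\<close> biject with the ring \<open>D\<close> of endomorphisms that have
  a \<open>g\<close>-adjoint, and the isotropic ones with the self-adjoint elements. Nonzero elements of \<open>D\<close> are
  injective, because distinct atoms intersect trivially, so \<open>D\<close> is a finite skew field, hence a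
  field by Wedderburn's theorem. The adjoint is an automorphism of \<open>D\<close> of order at most 2, so
  its fixed field \<open>T\<close> satisfies \<open>|D| = |T|\<close> or \<open>|D| = |T|\<^sup>2\<close>; and \<open>A\<close> is a vector space over \<open>D\<close>,
  which gives \<open>a dvd n\<close>.\<close>

section \<open>Cyclotomic values\<close>

lemma map_poly_of_int_mult:
  "map_poly of_int (P * Q) = (map_poly of_int P * map_poly of_int Q :: 'a::comm_ring_1 poly)"
  by (rule poly_eqI) (simp add: coeff_map_poly Polynomial.coeff_mult)

lemma poly_map_poly_of_int: "poly (map_poly of_int P) (of_int x) = (of_int (poly P x) :: 'a::comm_ring_1)"
  by (induction P) (auto simp: map_poly_pCons)

text \<open>Over the complex numbers \<open>F\<close> splits into linear factors. Every root
  \<open>z\<close> has norm 1, so \<open>|q - z| \<ge> q - 1 \<ge> 1\<close>, and a root other than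
  1 makes its factor strictly larger than \<open>q - 1\<close>. This is the size estimate in Witt's
  proof of Wedderburn's theorem.\<close>

lemma norm_poly_gt:
  fixes F :: "complex poly" and q :: real
  assumes "F \<noteq> 0" and roots: "\<And>z. poly F z = 0 \<Longrightarrow> norm z = 1"
    and q: "q \<ge> 2" and "poly F \<zeta> = 0" and "\<zeta> \<noteq> 1"
  shows "norm (poly F (of_real q)) > norm (Polynomial.lead_coeff F) * (q - 1)"
proof -
  let ?R = "{z. poly F z = 0}"
  let ?f = "\<lambda>z. norm (of_real q - z) ^ Polynomial.order z F"
  have fin: "finite ?R"
    using \<open>F \<noteq> 0\<close> by (rule poly_roots_finite)
  have ge: "norm (of_real q - z) \<ge> q - 1" if "z \<in> ?R" for z
    using norm_triangle_ineq2[of "of_real q" z] roots[of z] that q by simp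
  have "poly F (of_real q) = poly (smult (Polynomial.lead_coeff F)
      (\<Prod>z\<in>?R. [:-z, 1:] ^ Polynomial.order z F)) (of_real q)"
    by (simp only: complex_poly_decompose)
  then have eq: "norm (poly F (of_real q)) = norm (Polynomial.lead_coeff F) * (\<Prod>z\<in>?R. ?f z)"
    by (simp add: poly_prod norm_mult norm_power flip: prod_norm)
  have "norm \<zeta> = 1"
    using roots assms(4) by blast
  \<comment> \<open>On the unit circle \<open>|q - \<zeta>|\<close> is smallest at 1 only: squaring
    the opposite inequality gives \<open>Re \<zeta> \<ge> 1\<close>, hence
    \<open>\<zeta> = 1\<close>.\<close>
  have strict: "norm (of_real q - \<zeta>) > q - 1"
  proof (rule ccontr)
    assume "\<not> norm (of_real q - \<zeta>) > q - 1"
    then have "(norm (of_real q - \<zeta>))\<^sup>2 \<le> (q - 1)\<^sup>2"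
      using q by (intro power_mono) auto
    moreover have "(norm (of_real q - \<zeta>))\<^sup>2 = (q - Re \<zeta>)\<^sup>2 + (Im \<zeta>)\<^sup>2"
      by (simp add: cmod_power2)
    moreover have unit: "(Re \<zeta>)\<^sup>2 + (Im \<zeta>)\<^sup>2 = 1"
      using \<open>norm \<zeta> = 1\<close> cmod_power2[of \<zeta>] by simp
    ultimately have "q * 1 \<le> q * Re \<zeta>"
      by (simp add: power2_eq_square algebra_simps)
    then have "1 \<le> Re \<zeta>"
      using q by (subst (asm) mult_le_cancel_left_pos) auto
    then have "1\<^sup>2 \<le> (Re \<zeta>)\<^sup>2"
      by (intro power_mono) auto
    with unit have "Im \<zeta> = 0"
      by (smt (verit) one_power2 zero_eq_power2 zero_le_power2)
    with unit \<open>1 \<le> Re \<zeta>\<close> have "Re \<zeta> = 1"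
      by (simp add: power2_eq_1_iff)
    with \<open>Im \<zeta> = 0\<close> show False
      using \<open>\<zeta> \<noteq> 1\<close> by (simp add: complex_eq_iff)
  qed
  have one: "?f z \<ge> 1" if "z \<in> ?R" for z
    using ge[OF that] q by (intro one_le_power) linarith
  have "Polynomial.order \<zeta> F \<noteq> 0"
    using \<open>F \<noteq> 0\<close> assms(4) order_root by blast
  then have "?f \<zeta> \<ge> norm (of_real q - \<zeta>)"
    using strict q by (intro self_le_power) auto
  moreover have "(\<Prod>z\<in>?R. ?f z) = ?f \<zeta> * (\<Prod>z\<in>?R - {\<zeta>}. ?f z)"
    using fin assms(4) by (intro prod.remove) auto
  moreover have "(\<Prod>z\<in>?R - {\<zeta>}. ?f z) \<ge> 1"
    by (rule prod_ge_1) (use one in auto)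
  ultimately have "(\<Prod>z\<in>?R. ?f z) > q - 1"
    using strict mult_left_mono[of 1 "\<Prod>z\<in>?R - {\<zeta>}. ?f z" "?f \<zeta>"] q by (smt (verit))
  with \<open>F \<noteq> 0\<close> show ?thesis
    unfolding eq by (intro mult_strict_left_mono) auto
qed

text \<open>Evaluation at \<zeta> is multiplicative into a field, so a product that vanishes there
  has a vanishing prime factor. Taking primes in the ring of integer polynomials keeps the quotients
  integral, so that divisibility passes to values at integers.\<close>

lemma prime_factor_with_root:
  fixes F :: "int poly" and \<zeta> :: complex
  assumes "F \<noteq> 0" and "poly (map_poly of_int F) \<zeta> = 0"
  shows "\<exists>P. prime_elem P \<and> P dvd F \<and> poly (map_poly of_int P) \<zeta> = 0"
  using assms
proof (induction F rule: prime_divisors_induct)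
  case (unit u)
  then obtain c where "u = [:c:]" "c dvd 1"
    using is_unit_polyE by blast
  then show ?case
    using unit by (auto simp: map_poly_pCons)
next
  case (factor P F)
  show ?case
  proof (cases "poly (map_poly of_int P) \<zeta> = 0")
    case True
    then show ?thesis
      using factor by (intro exI[of _ P]) auto
  next
    case False
    then have "poly (map_poly of_int F) \<zeta> = 0" "F \<noteq> 0"
      using factor by (auto simp: map_poly_of_int_mult)
    then show ?thesis
      using factor by (meson dvd_mult)
  qed
qed simp

text \<open>The witness is the value at \<open>q\<close> of the \<open>n\<close>-th cyclotomic polynomial, obtained as
  a prime factor of \<open>X\<^sup>n - 1\<close> over the integers that has a primitive root of unity as a root.\<close>

lemma cyclotomic_value_exists:
  fixes q :: int and n :: nat
  assumes "q \<ge> 2" and "n > 1"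
  obtains m :: int where "m dvd q ^ n - 1" and "\<not> m dvd q - 1"
    and "\<And>d s. d > 0 \<Longrightarrow> d < n \<Longrightarrow> d dvd n \<Longrightarrow> s * (q ^ d - 1) = q ^ n - 1 \<Longrightarrow> m dvd s"
proof -
  define F where "F k = (Polynomial.monom 1 k - 1 :: int poly)" for k
  have F_poly: "poly (F k) y = y ^ k - 1" for k y
    by (simp add: F_def poly_monom)
  have "map_poly of_int (F k) = (Polynomial.monom 1 k - 1 :: complex poly)" for k
    by (rule poly_eqI) (simp add: F_def coeff_map_poly)
  then have F_cpoly: "poly (map_poly of_int (F k)) y = y ^ k - 1" for k and y :: complex
    by (simp add: poly_monom)
  \<comment> \<open>A primitive \<open>n\<close>-th root of unity; it is a root of
    \<open>F n\<close> but of no \<open>F d\<close> with \<open>0 < d < n\<close>.\<close>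
  define \<zeta> where "\<zeta> = cis (2 * pi / n)"
  have \<zeta>n: "\<zeta> ^ n = 1"
    using assms(2) by (simp add: \<zeta>_def DeMoivre)
  have prim: "\<zeta> ^ d \<noteq> 1" if "d > 0" "d < n" for d
  proof
    assume "\<zeta> ^ d = 1"
    moreover have "\<zeta> ^ d = cis (2 * pi * d / n)" "\<zeta> ^ 0 = cis (2 * pi * 0 / n)"
      by (auto simp: \<zeta>_def DeMoivre mult.commute)
    moreover have "inj_on (\<lambda>k. cis (2 * pi * real k / real n)) {..<n}"
      using bij_betw_roots_unity[of n] assms(2) by (auto simp: bij_betw_def)
    ultimately show False
      using that by (auto dest!: inj_onD[of _ _ d 0])
  qed
  have F_nz: "F k \<noteq> 0" if "k > 0" for k
    using F_poly[of k 0] that by (auto simp: power_0_left)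
  obtain P where P: "prime_elem P" "P dvd F n" "poly (map_poly of_int P) \<zeta> = 0"
    using prime_factor_with_root[of "F n" \<zeta>] F_nz[of n] F_cpoly[of n \<zeta>] \<zeta>n assms(2) by auto
  then have "P \<noteq> 0"
    by auto
  show thesis
  proof
    show "poly P q dvd q ^ n - 1"
      using P(2) F_poly[of n q] by (metis dvdE dvd_triv_left poly_mult)
    show "poly P q dvd s" if ds: "d > 0" "d < n" "d dvd n" "s * (q ^ d - 1) = q ^ n - 1" for d s
    proof -
      obtain e where "n = d * e"
        using \<open>d dvd n\<close> by blast
      define Q where "Q = (\<Sum>i<e. Polynomial.monom (1::int) (d * i))"
      have factor: "F n = F d * Q"
      proof -
        have "Polynomial.monom (1::int) d ^ e - 1 = (Polynomial.monom 1 d - 1) * (\<Sum>i<e. Polynomial.monom 1 d ^ i)"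
          by (rule power_diff_1_eq)
        then show ?thesis
          by (simp add: F_def Q_def \<open>n = d * e\<close> monom_power mult.commute)
      qed
      \<comment> \<open>\<open>P\<close> vanishes at \<zeta> and \<open>F d\<close> does not. As
        \<open>P\<close> is prime and divides \<open>F d * Q\<close>, it must divide
        \<open>Q\<close>, and the value of \<open>Q\<close> at \<open>q\<close> is
        \<open>s\<close>.\<close>
      have "\<not> P dvd F d"
        using P(3) F_cpoly[of d \<zeta>] prim[OF ds(1,2)] by (auto simp: map_poly_of_int_mult elim!: dvdE)
      then have "P dvd Q"
        using P(1,2) factor by (auto dest: prime_elem_dvd_multD)
      then have "poly P q dvd poly Q q"
        by (auto elim!: dvdE)
      moreover have "(q ^ d - 1) * poly Q q = (q ^ d - 1) * s"
        using factor F_poly[of n q] F_poly[of d q] ds(4) by (simp add: mult.commute)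
      moreover have "q ^ d > 1"
        using \<open>d > 0\<close> assms(1) by (intro one_less_power) auto
      ultimately show ?thesis
        by simp
    qed
    \<comment> \<open>A matter of size: all roots of \<open>P\<close> are roots of unity, and its
      leading coefficient is a nonzero integer, so \<open>|P(q)| > q - 1 > 0\<close>.\<close>
    show "\<not> poly P q dvd q - 1"
    proof
      assume "poly P q dvd q - 1"
      then have le: "\<bar>poly P q\<bar> \<le> q - 1"
        using assms(1) dvd_imp_le_int[of "q - 1" "poly P q"] by auto
      let ?P = "map_poly of_int P :: complex poly"
      have deg: "Polynomial.degree ?P = Polynomial.degree P"
        by (rule degree_map_poly) auto
      have nz: "?P \<noteq> 0"
        using \<open>P \<noteq> 0\<close> by (subst map_poly_eq_0_iff) auto
      have "norm z = 1" if "poly ?P z = 0" for z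
      proof -
        have "z ^ n = 1"
          using P(2) F_cpoly[of n z] that by (auto simp: map_poly_of_int_mult elim!: dvdE)
        then show ?thesis
          using assms(2) by (metis norm_ge_zero norm_one norm_power power_eq_1_iff less_nat_zero_code gr0I zero_less_one less_trans)
      qed
      moreover have "\<zeta> \<noteq> 1"
        using prim[of 1] assms(2) by simp
      ultimately have "norm (poly ?P (of_real (of_int q))) > norm (Polynomial.lead_coeff ?P) * (of_int q - 1)"
        using P(3) nz assms(1) by (intro norm_poly_gt[where \<zeta> = \<zeta>]) auto
      moreover have "poly ?P (of_real (of_int q)) = of_int (poly P q)"
        using poly_map_poly_of_int[of P q] by simp
      moreover have "Polynomial.lead_coeff ?P = of_int (Polynomial.lead_coeff P)"
        by (simp add: deg coeff_map_poly)
      ultimately have gt: "\<bar>of_int (poly P q)\<bar> > \<bar>of_int (Polynomial.lead_coeff P)\<bar> * (of_int q - 1 :: real)"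
        by simp
      have "real_of_int \<bar>poly P q\<bar> > real_of_int (\<bar>Polynomial.lead_coeff P\<bar> * (q - 1))"
        using gt by simp
      then have "\<bar>poly P q\<bar> > \<bar>Polynomial.lead_coeff P\<bar> * (q - 1)"
        by (simp only: of_int_less_iff)
      moreover have "\<bar>Polynomial.lead_coeff P\<bar> * (q - 1) \<ge> 1 * (q - 1)"
        using \<open>P \<noteq> 0\<close> assms(1) leading_coeff_0_iff[of P] by (intro mult_right_mono) linarith+
      ultimately show False
        using le by simp
    qed
  qed
qed

section \<open>Finite skew fields\<close>

text \<open>A module over a skew field is free. Instead of building a basis, take a submodule
  \<open>N\<close> that is maximal among those whose order is a power of \<open>|R|\<close>; if
  \<open>N\<close> misses \<open>x\<close>, then \<open>N + R x\<close> is a larger one. The skew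
  field is described through \<open>Units R\<close>, since the lemma also serves the proof of
  Wedderburn's theorem.\<close>

lemma card_skew_field_module:
  assumes "ring R" and "finite (carrier R)" and units: "Units R = carrier R - {\<zero>\<^bsub>R\<^esub>}"
    and "comm_group V" and "finite (carrier V)"
    and hom: "\<And>r. r \<in> carrier R \<Longrightarrow> act r \<in> hom V V"
    and add: "\<And>r s x. r \<in> carrier R \<Longrightarrow> s \<in> carrier R \<Longrightarrow> x \<in> carrier V \<Longrightarrow>
      act (r \<oplus>\<^bsub>R\<^esub> s) x = act r x \<otimes>\<^bsub>V\<^esub> act s x"
    and mult: "\<And>r s x. r \<in> carrier R \<Longrightarrow> s \<in> carrier R \<Longrightarrow> x \<in> carrier V \<Longrightarrow>
      act (r \<otimes>\<^bsub>R\<^esub> s) x = act r (act s x)"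
    and one: "\<And>x. x \<in> carrier V \<Longrightarrow> act \<one>\<^bsub>R\<^esub> x = x"
  obtains k where "card (carrier V) = card (carrier R) ^ k"
proof -
  interpret R: ring R by fact
  interpret V: comm_group V by fact
  have closed [simp]: "act r x \<in> carrier V" if "r \<in> carrier R" "x \<in> carrier V" for r x
    using hom[OF that(1)] that(2) by (auto simp: hom_def)
  have distrib: "act r (x \<otimes>\<^bsub>V\<^esub> y) = act r x \<otimes>\<^bsub>V\<^esub> act r y"
    if "r \<in> carrier R" "x \<in> carrier V" "y \<in> carrier V" for r x y
    using hom[OF that(1)] that(2,3) by (auto simp: hom_def)
  have zero: "act \<zero>\<^bsub>R\<^esub> x = \<one>\<^bsub>V\<^esub>" if "x \<in> carrier V" for x
    using add[of "\<zero>\<^bsub>R\<^esub>" "\<zero>\<^bsub>R\<^esub>" x] that by (simp add: V.l_cancel_one')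
  have minus: "act (\<ominus>\<^bsub>R\<^esub> r) x = inv\<^bsub>V\<^esub> (act r x)" if "r \<in> carrier R" "x \<in> carrier V" for r x
    using add[of "\<ominus>\<^bsub>R\<^esub> r" r x] that
    by (intro V.inv_equality[symmetric]) (auto simp: R.l_neg zero)
  define submod where "submod N \<longleftrightarrow> subgroup N V \<and> (\<forall>r\<in>carrier R. \<forall>x\<in>N. act r x \<in> N)" for N
  define S where "S = {N. submod N \<and> (\<exists>k. card N = card (carrier R) ^ k)}"
  have "S \<subseteq> Pow (carrier V)"
    by (auto simp: S_def submod_def dest: subgroup.subset)
  then have "finite S"
    using \<open>finite (carrier V)\<close> by (meson finite_Pow_iff finite_subset)
  have "act r \<one>\<^bsub>V\<^esub> = \<one>\<^bsub>V\<^esub>" if "r \<in> carrier R" for r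
    using distrib[of r "\<one>\<^bsub>V\<^esub>" "\<one>\<^bsub>V\<^esub>"] that by (simp add: V.l_cancel_one')
  then have "{\<one>\<^bsub>V\<^esub>} \<in> S"
    by (auto simp: S_def submod_def V.triv_subgroup intro: exI[of _ 0])
  then obtain N where "N \<in> S" and max: "\<And>N'. N' \<in> S \<Longrightarrow> N \<subseteq> N' \<Longrightarrow> N = N'"
    using finite_has_maximal2[OF \<open>finite S\<close>] by metis
  then obtain k where N: "subgroup N V" "\<And>r x. r \<in> carrier R \<Longrightarrow> x \<in> N \<Longrightarrow> act r x \<in> N"
      and k: "card N = card (carrier R) ^ k"
    by (auto simp: S_def submod_def)
  interpret N: subgroup N V by fact
  have NV [simp]: "y \<in> carrier V" if "y \<in> N" for y
    using N.subset that by auto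
  have "N = carrier V"
  proof (rule ccontr)
    assume "N \<noteq> carrier V"
    then obtain x where x: "x \<in> carrier V" "x \<notin> N"
      using N.subset by blast
    \<comment> \<open>The parametrisation of \<open>N + R x\<close> by \<open>N \<times> R\<close>;
      its injectivity gives the order \<open>|R|^(k+1)\<close>.\<close>
    define f where "f = (\<lambda>(y, r). y \<otimes>\<^bsub>V\<^esub> act r x)"
    \<comment> \<open>A nonzero \<open>r - s\<close> would be invertible, and its inverse would
      carry \<open>(r - s) x \<in> N\<close> to \<open>x\<close>, which lies outside
      \<open>N\<close>.\<close>
    have eq_if: "r = s" if rs: "r \<in> carrier R" "s \<in> carrier R" "act (r \<ominus>\<^bsub>R\<^esub> s) x \<in> N" for r s
    proof (rule ccontr)
      assume "r \<noteq> s"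
      then have "r \<ominus>\<^bsub>R\<^esub> s \<in> Units R"
        using rs by (simp add: units)
      then obtain u where "u \<in> carrier R" "u \<otimes>\<^bsub>R\<^esub> (r \<ominus>\<^bsub>R\<^esub> s) = \<one>\<^bsub>R\<^esub>"
        by (auto simp: Units_def)
      then have "x = act u (act (r \<ominus>\<^bsub>R\<^esub> s) x)"
        using rs x mult[of u "r \<ominus>\<^bsub>R\<^esub> s" x] one[of x] by simp
      also have "\<dots> \<in> N"
        using N(2) rs \<open>u \<in> carrier R\<close> by blast
      finally show False
        using x by blast
    qed
    have "inj_on f (N \<times> carrier R)"
    proof (rule inj_onI, clarsimp simp: f_def)
      fix y r z s
      assume y: "y \<in> N" and r: "r \<in> carrier R" and z: "z \<in> N" and s: "s \<in> carrier R"
        and eq: "y \<otimes>\<^bsub>V\<^esub> act r x = z \<otimes>\<^bsub>V\<^esub> act s x"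
      have "act (r \<ominus>\<^bsub>R\<^esub> s) x = act r x \<otimes>\<^bsub>V\<^esub> inv\<^bsub>V\<^esub> (act s x)"
        using r s x by (simp add: R.minus_eq add minus)
      also have "\<dots> = inv\<^bsub>V\<^esub> y \<otimes>\<^bsub>V\<^esub> (y \<otimes>\<^bsub>V\<^esub> act r x) \<otimes>\<^bsub>V\<^esub> inv\<^bsub>V\<^esub> (act s x)"
        using y r s x by (simp flip: V.m_assoc)
      also have "\<dots> = inv\<^bsub>V\<^esub> y \<otimes>\<^bsub>V\<^esub> z"
        unfolding eq using y z r s x by (simp add: V.m_assoc)
      also have "\<dots> \<in> N"
        using y z by simp
      finally have "r = s"
        using eq_if r s by blast
      with eq show "y = z \<and> r = s"
        using y z r x by simp
    qed
    then have "card (f ` (N \<times> carrier R)) = card (carrier R) ^ Suc k"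
      by (simp add: card_image card_cartesian_product k)
    moreover have "submod (f ` (N \<times> carrier R))"
      unfolding submod_def
    proof (intro conjI ballI)
      show "subgroup (f ` (N \<times> carrier R)) V"
      proof (rule V.subgroupI)
        show "f ` (N \<times> carrier R) \<subseteq> carrier V"
          using x by (auto simp: f_def)
        show "f ` (N \<times> carrier R) \<noteq> {}"
          using N.one_closed R.zero_closed by blast
        show "inv\<^bsub>V\<^esub> a \<in> f ` (N \<times> carrier R)" if "a \<in> f ` (N \<times> carrier R)" for a
        proof -
          from that obtain y r where "y \<in> N" "r \<in> carrier R" "a = f (y, r)"
            by auto
          then have "inv\<^bsub>V\<^esub> a = f (inv\<^bsub>V\<^esub> y, \<ominus>\<^bsub>R\<^esub> r)" "(inv\<^bsub>V\<^esub> y, \<ominus>\<^bsub>R\<^esub> r) \<in> N \<times> carrier R"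
            using x by (auto simp: f_def minus V.inv_mult)
          then show ?thesis
            by blast
        qed
        show "a \<otimes>\<^bsub>V\<^esub> b \<in> f ` (N \<times> carrier R)"
          if "a \<in> f ` (N \<times> carrier R)" "b \<in> f ` (N \<times> carrier R)" for a b
        proof -
          from that obtain y r z s where
            "y \<in> N" "r \<in> carrier R" "a = f (y, r)" "z \<in> N" "s \<in> carrier R" "b = f (z, s)"
            by auto
          then have "a \<otimes>\<^bsub>V\<^esub> b = f (y \<otimes>\<^bsub>V\<^esub> z, r \<oplus>\<^bsub>R\<^esub> s)" "(y \<otimes>\<^bsub>V\<^esub> z, r \<oplus>\<^bsub>R\<^esub> s) \<in> N \<times> carrier R"
            using x by (auto simp: f_def add V.m_ac)
          then show ?thesis
            by blast
        qed
      qed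
      show "act r a \<in> f ` (N \<times> carrier R)" if "r \<in> carrier R" "a \<in> f ` (N \<times> carrier R)" for r a
      proof -
        from that(2) obtain y s where "y \<in> N" "s \<in> carrier R" "a = f (y, s)"
          by auto
        then have "act r a = f (act r y, r \<otimes>\<^bsub>R\<^esub> s)" "(act r y, r \<otimes>\<^bsub>R\<^esub> s) \<in> N \<times> carrier R"
          using x that(1) N(2) by (auto simp: f_def distrib mult)
        then show ?thesis
          by blast
      qed
    qed
    ultimately have "f ` (N \<times> carrier R) \<in> S"
      unfolding S_def by blast
    moreover have "N \<subseteq> f ` (N \<times> carrier R)"
    proof
      fix y assume "y \<in> N"
      then show "y \<in> f ` (N \<times> carrier R)"
        using x by (intro image_eqI[of _ f "(y, \<zero>\<^bsub>R\<^esub>)"]) (auto simp: f_def zero)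
    qed
    ultimately have "N = f ` (N \<times> carrier R)"
      by (rule max)
    moreover have "x \<in> f ` (N \<times> carrier R)"
      using x by (intro image_eqI[of _ f "(\<one>\<^bsub>V\<^esub>, \<one>\<^bsub>R\<^esub>)"]) (auto simp: f_def one)
    ultimately show False
      using x by blast
  qed
  with k show thesis
    using that by blast
qed

section \<open>Commutants and Wedderburn's theorem on finite skew fields\<close>

context ring
begin

text \<open>Covers both the center of the ring (\<open>S = carrier R\<close>) and the centralizer of
  a single element (\<open>S = {x}\<close>), the two kinds of subring that occur in the class
  equation.\<close>

definition commutant :: "'a set \<Rightarrow> 'a set" where
  "commutant S = {y \<in> carrier R. \<forall>x\<in>S. x \<otimes> y = y \<otimes> x}"

lemma subring_commutant:
  assumes "S \<subseteq> carrier R"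
  shows "subring (commutant S) R"
proof (rule subringI)
  show "h1 \<otimes> h2 \<in> commutant S" if "h1 \<in> commutant S" "h2 \<in> commutant S" for h1 h2
  proof -
    have "x \<otimes> (h1 \<otimes> h2) = h1 \<otimes> h2 \<otimes> x" if "x \<in> S" for x
    proof -
      have "x \<in> carrier R" "h1 \<in> carrier R" "h2 \<in> carrier R" "x \<otimes> h1 = h1 \<otimes> x" "x \<otimes> h2 = h2 \<otimes> x"
        using that \<open>h1 \<in> _\<close> \<open>h2 \<in> _\<close> assms by (auto simp: commutant_def)
      then show ?thesis
        by (metis m_assoc)
    qed
    with that show ?thesis
      by (auto simp: commutant_def)
  qed
qed (use assms in \<open>auto simp: commutant_def l_minus r_minus l_distr r_distr subset_iff\<close>)

text \<open>If \<open>y\<close> commutes with \<open>x\<close>, so does its inverse. Hence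
  commutants in a skew field are skew fields.\<close>

lemma Units_commutant:
  assumes "S \<subseteq> carrier R" and units: "Units R = carrier R - {\<zero>}"
  shows "Units (R\<lparr>carrier := commutant S\<rparr>) = commutant S - {\<zero>}"
proof (intro equalityI subsetI)
  fix y assume "y \<in> Units (R\<lparr>carrier := commutant S\<rparr>)"
  then have "y \<in> commutant S" "y \<in> Units R"
    by (auto simp: Units_def commutant_def)
  then show "y \<in> commutant S - {\<zero>}"
    using units by blast
next
  fix y assume y: "y \<in> commutant S - {\<zero>}"
  then have U: "y \<in> Units R"
    by (auto simp: units commutant_def)
  have "x \<otimes> inv y = inv y \<otimes> x" if "x \<in> S" for x
  proof -
    have x: "x \<in> carrier R" "x \<otimes> y = y \<otimes> x"
      using that assms y by (auto simp: commutant_def)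
    have y': "y \<in> carrier R" "inv y \<in> carrier R"
      using U by auto
    have "x \<otimes> inv y = inv y \<otimes> y \<otimes> x \<otimes> inv y"
      using U x by simp
    also have "\<dots> = inv y \<otimes> (x \<otimes> y) \<otimes> inv y"
      unfolding x(2) using y' x(1) by (simp add: m_assoc)
    also have "\<dots> = inv y \<otimes> x"
      using U y' x(1) by (simp add: m_assoc)
    finally show ?thesis .
  qed
  then have "inv y \<in> commutant S"
    using U by (auto simp: commutant_def)
  with U y show "y \<in> Units (R\<lparr>carrier := commutant S\<rparr>)"
    by (auto simp: Units_def[of "R\<lparr>carrier := _\<rparr>"] intro!: bexI[of _ "inv y"])
qed

text \<open>\<open>K\<close> is a module over the skew field \<open>H\<close> by left
  multiplication.\<close>

lemma card_subring_power:
  assumes "subring H R" and "subring K R" and "H \<subseteq> K" and "finite K"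
    and units: "Units (R\<lparr>carrier := H\<rparr>) = H - {\<zero>}"
  obtains k where "card K = card H ^ k"
proof -
  interpret K: ring "R\<lparr>carrier := K\<rparr>"
    using subring_is_ring assms(2) .
  have HK: "h \<in> K" "h \<in> carrier R" if "h \<in> H" for h
    using that assms(3) subringE(1)[OF assms(2)] by auto
  have KR: "h \<in> carrier R" if "h \<in> K" for h
    using that subringE(1)[OF assms(2)] by auto
  show thesis
  proof (rule card_skew_field_module[where act = "\<lambda>r x. r \<otimes> x"])
    show "ring (R\<lparr>carrier := H\<rparr>)"
      using subring_is_ring assms(1) .
    show "comm_group (add_monoid (R\<lparr>carrier := K\<rparr>))"
      by (rule K.a_comm_group)
    show "finite (carrier (R\<lparr>carrier := H\<rparr>))"
      using assms(3,4) finite_subset by auto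
    show "(\<otimes>) r \<in> hom (add_monoid (R\<lparr>carrier := K\<rparr>)) (add_monoid (R\<lparr>carrier := K\<rparr>))"
      if "r \<in> carrier (R\<lparr>carrier := H\<rparr>)" for r
      using that HK KR subringE(6)[OF assms(2)] by (auto simp: hom_def r_distr)
  qed (use assms(4) units that HK KR in \<open>auto simp: l_distr m_assoc\<close>)
qed

text \<open>Witt's proof of Wedderburn's theorem. With \<open>q\<close> the order of the center and
  \<open>q^n\<close> that of the ring, the class equation of the unit group is read modulo a
  cyclotomic value \<open>m\<close>: it divides \<open>q^n - 1\<close> and the size of every
  noncentral class, hence also \<open>q - 1\<close>, which it does not.\<close>

theorem finite_skew_field_commute:
  assumes "finite (carrier R)" and units: "Units R = carrier R - {\<zero>}"
    and "x \<in> carrier R" and "y \<in> carrier R"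
  shows "x \<otimes> y = y \<otimes> x"
proof (rule ccontr)
  assume noncomm: "x \<otimes> y \<noteq> y \<otimes> x"
  define Z where "Z = commutant (carrier R)"
  define C where "C x = commutant {x}" for x
  define q where "q = card Z"
  have Z: "subring Z R" "Units (R\<lparr>carrier := Z\<rparr>) = Z - {\<zero>}" "Z \<subseteq> carrier R"
    using subring_commutant Units_commutant units by (auto simp: Z_def commutant_def)
  have C: "subring (C x) R" "Units (R\<lparr>carrier := C x\<rparr>) = C x - {\<zero>}" "Z \<subseteq> C x" "C x \<subseteq> carrier R"
    if "x \<in> carrier R" for x
    using that subring_commutant[of "{x}"] Units_commutant[of "{x}"] units
    by (auto simp: C_def Z_def commutant_def)
  have "finite Z"
    using Z(3) assms(1) finite_subset by blast
  have "\<one> \<noteq> \<zero>"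
    using units Units_one_closed by auto
  then have "card {\<zero>, \<one>} = 2"
    by simp
  moreover have "{\<zero>, \<one>} \<subseteq> Z"
    using subringE(2,3)[OF Z(1)] by auto
  ultimately have "q \<ge> 2"
    using \<open>finite Z\<close> card_mono q_def by metis
  obtain n where n: "card (carrier R) = q ^ n"
    using card_subring_power[OF Z(1) carrier_is_subring Z(3) assms(1) Z(2)] q_def by metis
  have "Z \<noteq> carrier R"
    using noncomm assms(3,4) by (auto simp: Z_def commutant_def)
  then have "q < q ^ n"
    using n Z(3) assms(1) by (metis psubsetI psubset_card_mono q_def)
  then have "n > 1"
    by (metis One_nat_def \<open>q \<ge> 2\<close> less_one linorder_neqE_nat not_less power_0 power_one_right order_less_irrefl le_trans one_le_numeral)
  obtain m where m: "m dvd int q ^ n - 1" "\<not> m dvd int q - 1"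
    and m_dvd: "\<And>d s. d > 0 \<Longrightarrow> d < n \<Longrightarrow> d dvd n \<Longrightarrow> s * (int q ^ d - 1) = int q ^ n - 1 \<Longrightarrow> m dvd s"
    using cyclotomic_value_exists[of "int q" n] \<open>q \<ge> 2\<close> \<open>n > 1\<close> by auto
  define U where "U = units_of R"
  have U_carrier: "carrier U = carrier R - {\<zero>}"
    by (simp add: U_def units_of_carrier units)
  interpret U: group U
    unfolding U_def by (rule units_group)
  have U_mult: "a \<otimes>\<^bsub>U\<^esub> b = a \<otimes> b" for a b
    by (simp add: U_def units_of_mult)
  have U_closed: "a \<in> carrier R" if "a \<in> carrier U" for a
    using that U_carrier by auto
  define \<phi> where "\<phi> = (\<lambda>g. \<lambda>h\<in>carrier U. g \<otimes>\<^bsub>U\<^esub> h \<otimes>\<^bsub>U\<^esub> inv\<^bsub>U\<^esub> g)"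
  interpret act: group_action U "carrier U" \<phi>
    unfolding \<phi>_def by (rule U.action_by_conjugation)
  have fixed_iff: "\<phi> g a = a \<longleftrightarrow> a \<otimes> g = g \<otimes> a" if "g \<in> carrier U" "a \<in> carrier U" for g a
  proof -
    have "\<phi> g a = a \<longleftrightarrow> g \<otimes>\<^bsub>U\<^esub> a = a \<otimes>\<^bsub>U\<^esub> g"
      using that by (simp add: \<phi>_def) (metis U.inv_solve_right U.m_closed)
    then show ?thesis
      by (auto simp: U_mult)
  qed
  have central_iff: "a \<in> Z \<longleftrightarrow> (\<forall>g\<in>carrier U. \<phi> g a = a)" if "a \<in> carrier U" for a
    using that U_closed[OF that] fixed_iff[OF _ that]
    by (auto simp: Z_def commutant_def U_carrier) (metis Diff_iff l_null r_null singletonD)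
  \<comment> \<open>Marks the noncentral elements. An orbit then has sum 0 if it consists of one
    central element, and its own size otherwise.\<close>
  let ?f = "\<lambda>a. if a \<in> Z then 0 else 1 :: int"
  have "m dvd (\<Sum>a\<in>orb. ?f a)" if orb: "orb \<in> orbits U (carrier U) \<phi>" for orb
  proof -
    obtain a where a: "a \<in> carrier U" "orb = orbit U \<phi> a"
      using orb by (auto simp: orbits_def)
    have orb_sub: "orb \<subseteq> carrier U"
      using orb act.orbits_coverture by blast
    show ?thesis
    proof (cases "\<exists>b\<in>orb. b \<in> Z")
      case True
      then obtain b where b: "b \<in> orb" "b \<in> Z" by blast
      then have "b \<in> carrier U"
        using orb_sub by blast
      then have "a \<in> orbit U \<phi> b"
        using act.orbit_sym a b by blast
      then have "a = b"
        using central_iff \<open>b \<in> carrier U\<close> b(2) by (auto simp: orbit_def)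
      then have "orb = {a}"
        using a b central_iff[OF a(1)] by (auto simp: orbit_def)
      with \<open>a = b\<close> b show ?thesis by simp
    next
      case False
      then have "(\<Sum>a\<in>orb. ?f a) = int (card orb)"
        by simp
      \<comment> \<open>The stabilizer is the unit group of the skew field \<open>C a\<close>. It
        has order \<open>q^d - 1\<close>, and \<open>d dvd n\<close> because the whole ring is a
        module over \<open>C a\<close>.\<close>
      have stab: "stabilizer U \<phi> a = C a - {\<zero>}"
        using a(1) fixed_iff U_closed
        by (auto simp: stabilizer_def C_def commutant_def U_carrier)
      obtain d where d: "card (C a) = q ^ d"
        using card_subring_power[OF Z(1) C(1)[OF U_closed] C(3)[OF U_closed] _ Z(2)] a(1) q_def
          C(4)[OF U_closed[OF a(1)]] assms(1) finite_subset by metis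
      obtain e where "card (carrier R) = card (C a) ^ e"
        using card_subring_power[OF C(1)[OF U_closed] carrier_is_subring C(4)[OF U_closed] assms(1) C(2)[OF U_closed]]
          a(1) by metis
      then have "q ^ n = q ^ (d * e)"
        using n d by (simp add: power_mult)
      then have "n = d * e"
        using \<open>q \<ge> 2\<close> by simp
      have "a \<notin> Z"
        using False a act.orbit_refl by blast
      then obtain b where "b \<in> carrier R" "b \<otimes> a \<noteq> a \<otimes> b"
        using U_closed[OF a(1)] by (auto simp: Z_def commutant_def)
      then have "C a \<noteq> carrier R"
        unfolding C_def commutant_def by force
      \<comment> \<open>Noncentrality of \<open>a\<close> makes \<open>d\<close> a proper divisor of
        \<open>n\<close>, as the divisibility property of \<open>m\<close> demands.\<close>
      then have "d \<noteq> n"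
        using C(4)[OF U_closed[OF a(1)]] d n assms(1) card_subset_eq by metis
      moreover have "d dvd n"
        using \<open>n = d * e\<close> by simp
      ultimately have "d dvd n" "d < n" "d > 0"
        using dvd_imp_le[of d n] \<open>n > 1\<close> by (auto intro: gr0I)
      moreover have "int (card orb) * (int q ^ d - 1) = int q ^ n - 1"
      proof -
        have "\<zero> \<in> C a"
          using subringE(2)[OF C(1)[OF U_closed[OF a(1)]]] .
        then have "card (C a - {\<zero>}) = q ^ d - 1" "card (carrier U) = q ^ n - 1"
          using C(4)[OF U_closed[OF a(1)]] d n by (auto simp: U_carrier)
        then have "card orb * (q ^ d - 1) = q ^ n - 1"
          using act.orbit_stabilizer_theorem[OF a(1)] a(2) stab by (simp add: Coset.order_def)
        then have "int (card orb) * int (q ^ d - 1) = int (q ^ n - 1)"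
          by (metis of_nat_mult)
        moreover have "q ^ k \<ge> 1" for k
          using \<open>q \<ge> 2\<close> by simp
        ultimately show ?thesis
          by (simp only: of_nat_diff of_nat_power of_nat_1)
      qed
      ultimately show ?thesis
        using m_dvd \<open>_ = int (card orb)\<close> by auto
    qed
  qed
  then have "m dvd (\<Sum>orb\<in>orbits U (carrier U) \<phi>. \<Sum>a\<in>orb. ?f a)"
    by (rule dvd_sum)
  also have "\<dots> = (\<Sum>a\<in>carrier U. ?f a)"
    by (rule act.disjoint_sum) (simp add: U_carrier assms(1))
  \<comment> \<open>The zero of the ring, absent from the unit group, is central, so dropping it
    changes no count of noncentral elements.\<close>
  also have "\<dots> = (\<Sum>a\<in>carrier R - Z. 1)"
    using subringE(2)[OF Z(1)] assms(1) by (intro sum.mono_neutral_cong_right) (auto simp: U_carrier)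
  also have "\<dots> = int (q ^ n) - int q"
    using \<open>q < q ^ n\<close> n card_Diff_subset[OF \<open>finite Z\<close> Z(3)] by (simp add: of_nat_diff flip: q_def)
  \<comment> \<open>The difference equals \<open>q - 1\<close>.\<close>
  finally have "m dvd (int q ^ n - 1) - (int (q ^ n) - int q)"
    using m(1) by (rule dvd_diff[rotated])
  with m(2) show False
    by simp
qed

end

text \<open>Another prime \<open>q\<close> dividing the order would yield a subgroup of order
  \<open>q\<close> by Sylow's theorem; a nontrivial element of it would have an order dividing both
  \<open>q\<close> and \<open>p\<close>.\<close>

lemma (in group) order_prime_power_if_exponent:
  assumes "finite (carrier G)" and p: "Factorial_Ring.prime p"
    and exp: "\<And>x. x \<in> carrier G \<Longrightarrow> x [^] (p::nat) = \<one>"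
  shows "\<exists>k. Coset.order G = p ^ k"
proof -
  have "Coset.order G \<noteq> 0"
    using assms(1) order_gt_0_iff_finite by simp
  then obtain m where m: "Coset.order G = p ^ multiplicity p (Coset.order G) * m" "\<not> p dvd m"
    using multiplicity_decompose'[of "Coset.order G" p] p not_prime_unit by metis
  have "m = 1"
  proof (rule ccontr)
    assume "m \<noteq> 1"
    then obtain q where q: "Factorial_Ring.prime q" "q dvd m"
      using prime_factor_nat by blast
    then have "q dvd Coset.order G"
      using m(1) by (metis dvd_mult)
    then obtain l where "Coset.order G = q ^ 1 * l"
      by (metis dvdE power_one_right)
    then obtain H where H: "subgroup H G" "card H = q"
      using sylow_thm[OF q(1) is_group _ assms(1), of 1 l] by auto
    have "\<not> H \<subseteq> {\<one>}"
      using H(2) q(1) prime_gt_1_nat[of q] card_mono[of "{\<one>}" H] by fastforce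
    then obtain x where x: "x \<in> H" "x \<noteq> \<one>"
      by blast
    then have xG: "x \<in> carrier G"
      using H(1) subgroup.subset by blast
    interpret H: group "G\<lparr>carrier := H\<rparr>"
      using H(1) subgroup.subgroup_is_group is_group by blast
    have "x [^] q = \<one>"
      using H.pow_order_eq_1[of x] x H(2) by (simp add: Coset.order_def nat_pow_consistent[symmetric])
    then have "ord x dvd q" "ord x dvd p"
      using pow_eq_id xG exp by auto
    moreover have "coprime p q"
      using p q m(2) by (metis primes_coprime)
    ultimately have "ord x = 1"
      by (metis coprime_common_divisor_nat)
    then show False
      using x xG ord_eq_1 by blast
  qed
  then show ?thesis
    using m by auto
qed

section \<open>Fixed points of an involution of a finite skew field\<close>

context cring
begin

text \<open>Applied with \<open>d\<close> the image of \<open>c\<close> under an involution that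
  fixes \<open>s\<close> and \<open>t\<close>: it shows how \<open>t\<close> is recovered from
  \<open>s + t c\<close>.\<close>

lemma add_diff_add_mult:
  assumes "s \<in> carrier R" "t \<in> carrier R" "c \<in> carrier R" "d \<in> carrier R"
  shows "s \<oplus> t \<otimes> c \<ominus> (s \<oplus> t \<otimes> d) = t \<otimes> (c \<ominus> d)"
  using assms by algebra

text \<open>Applied with \<open>e\<close> and \<open>c'\<close> the images of \<open>d\<close> and
  \<open>c\<close> under an involution: then \<open>d - t c\<close> is a fixed point.\<close>

lemma diff_mult_eq_diff_mult:
  assumes "d \<in> carrier R" "e \<in> carrier R" "t \<in> carrier R" "c \<in> carrier R" "c' \<in> carrier R"
    and "d \<ominus> e = t \<otimes> (c \<ominus> c')"
  shows "e \<ominus> t \<otimes> c' = d \<ominus> t \<otimes> c"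
proof -
  have "(d \<ominus> t \<otimes> c) \<ominus> (e \<ominus> t \<otimes> c') = (d \<ominus> e) \<ominus> t \<otimes> (c \<ominus> c')"
    using assms(1-5) by algebra
  also have "\<dots> = \<zero>"
    using assms by (simp add: minus_eq r_neg)
  finally show ?thesis
    using assms(1-5) by simp
qed

lemma diff_add_cancel:
  assumes "s \<in> carrier R" "t \<in> carrier R"
  shows "s \<ominus> t \<oplus> t = s"
  using assms by algebra

end

context ring
begin

text \<open>Left multiplication by a nonzero element is injective, hence surjective on a finite
  ring. So each nonzero \<open>a\<close> has a right inverse \<open>b\<close>, and the right inverse
  of \<open>b\<close> must be \<open>a\<close> itself.\<close>

lemma finite_Units_if_no_zero_divisors:
  assumes "finite (carrier R)" and "\<one> \<noteq> \<zero>"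
    and nzd: "\<And>a b. a \<in> carrier R \<Longrightarrow> b \<in> carrier R \<Longrightarrow> a \<otimes> b = \<zero> \<Longrightarrow> a = \<zero> \<or> b = \<zero>"
  shows "Units R = carrier R - {\<zero>}"
proof -
  have right_inv: "\<exists>b\<in>carrier R. a \<otimes> b = \<one>" if a: "a \<in> carrier R" "a \<noteq> \<zero>" for a
  proof -
    have "inj_on ((\<otimes>) a) (carrier R)"
    proof (rule inj_onI)
      fix b c assume bc: "b \<in> carrier R" "c \<in> carrier R" "a \<otimes> b = a \<otimes> c"
      then have "a \<otimes> (b \<ominus> c) = \<zero>"
        using a by (simp add: minus_eq r_distr r_minus r_neg)
      then have "b \<ominus> c = \<zero>"
        using nzd[of a "b \<ominus> c"] a bc by auto
      then show "b = c"
        using bc by simp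
    qed
    then have "(\<otimes>) a ` carrier R = carrier R"
      using assms(1) a by (intro endo_inj_surj) auto
    then show ?thesis
      using one_closed by (metis imageE)
  qed
  have "a \<in> Units R" if a: "a \<in> carrier R" "a \<noteq> \<zero>" for a
  proof -
    obtain b where b: "b \<in> carrier R" "a \<otimes> b = \<one>"
      using right_inv a by blast
    then have "b \<noteq> \<zero>"
      using a assms(2) by auto
    then obtain c where c: "c \<in> carrier R" "b \<otimes> c = \<one>"
      using right_inv b by blast
    have "a = a \<otimes> (b \<otimes> c)"
      using a c by simp
    also have "\<dots> = c"
      using a b c m_assoc[of a b c] by simp
    finally show ?thesis
      using a b c by (auto simp: Units_def)
  qed
  moreover have "\<zero> \<notin> Units R"
    using assms(2) by (auto simp: Units_def)
  ultimately show ?thesis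
    by auto
qed

text \<open>By Wedderburn's theorem \<open>R\<close> is a field, so the anti-automorphism \<theta>
  is an automorphism with fixed field \<open>T\<close>. If it moves some \<open>c\<close>, then 1
  and \<open>c\<close> form a basis of \<open>R\<close> over \<open>T\<close>. Working with
  \<open>\<delta> = c - \<theta> c\<close> instead of dividing by 2 covers characteristic 2 as
  well.\<close>

lemma card_fixed_points_involution:
  assumes "finite (carrier R)" and units: "Units R = carrier R - {\<zero>}"
    and closed [simp]: "\<And>x. x \<in> carrier R \<Longrightarrow> \<theta> x \<in> carrier R"
    and add: "\<And>x y. x \<in> carrier R \<Longrightarrow> y \<in> carrier R \<Longrightarrow> \<theta> (x \<oplus> y) = \<theta> x \<oplus> \<theta> y"
    and mult: "\<And>x y. x \<in> carrier R \<Longrightarrow> y \<in> carrier R \<Longrightarrow> \<theta> (x \<otimes> y) = \<theta> y \<otimes> \<theta> x"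
    and invol: "\<And>x. x \<in> carrier R \<Longrightarrow> \<theta> (\<theta> x) = x"
  defines "T \<equiv> {x \<in> carrier R. \<theta> x = x}"
  shows "card T = card (carrier R) \<or> (card T)\<^sup>2 = card (carrier R)"
proof (cases "T = carrier R")
  case False
  then obtain c where c: "c \<in> carrier R" "\<theta> c \<noteq> c"
    by (auto simp: T_def)
  interpret cring R
    using finite_skew_field_commute[OF assms(1) units]
    by unfold_locales auto
  interpret field R
    by (rule cring_fieldI) (rule units)
  have zero: "\<theta> \<zero> = \<zero>"
    using add[of \<zero> \<zero>] by (metis add.r_cancel_one closed r_zero zero_closed)
  have minus: "\<theta> (x \<ominus> y) = \<theta> x \<ominus> \<theta> y" if "x \<in> carrier R" "y \<in> carrier R" for x y
  proof -
    have "\<theta> (\<ominus> y) = \<ominus> \<theta> y"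
      using add[of "\<ominus> y" y] that by (intro minus_equality[symmetric]) (auto simp: l_neg zero)
    then show ?thesis
      using that by (simp add: minus_eq add)
  qed
  define \<delta> where "\<delta> = c \<ominus> \<theta> c"
  have \<delta>: "\<delta> \<in> carrier R" "\<delta> \<noteq> \<zero>"
    using c by (auto simp: \<delta>_def)
  have \<theta>\<delta>: "\<theta> \<delta> = \<ominus> \<delta>"
  proof -
    have "\<theta> \<delta> = \<theta> c \<ominus> c"
      using c by (simp add: \<delta>_def minus invol)
    also have "\<dots> = \<ominus> \<delta>"
      using c by (simp add: \<delta>_def minus_eq minus_add a_comm)
    finally show ?thesis .
  qed
  have T: "s \<in> carrier R" "\<theta> s = s" if "s \<in> T" for s
    using that by (auto simp: T_def)
  let ?f = "\<lambda>(s, t). s \<oplus> t \<otimes> c"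
  have f_diff: "(s \<oplus> t \<otimes> c) \<ominus> \<theta> (s \<oplus> t \<otimes> c) = t \<otimes> \<delta>" if "s \<in> T" "t \<in> T" for s t
    using T[OF that(1)] T[OF that(2)] c
    by (simp add: add mult \<delta>_def m_comm[of _ t] add_diff_add_mult)
  have "inj_on ?f (T \<times> T)"
  proof (rule inj_onI, clarsimp)
    fix s t s' t' assume st: "s \<in> T" "t \<in> T" "s' \<in> T" "t' \<in> T"
      and eq: "s \<oplus> t \<otimes> c = s' \<oplus> t' \<otimes> c"
    have "t \<otimes> \<delta> = t' \<otimes> \<delta>"
      using f_diff[OF st(1,2)] f_diff[OF st(3,4)] eq by simp
    then have "t = t'"
      using \<delta> st T m_rcancel by metis
    then show "s = s' \<and> t = t'"
      using eq st T c by (metis add.r_cancel m_closed)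
  qed
  moreover have "?f ` (T \<times> T) = carrier R"
  proof (intro equalityI subsetI)
    show "d \<in> carrier R" if "d \<in> ?f ` (T \<times> T)" for d
      using that T c by auto
    fix d assume d: "d \<in> carrier R"
    obtain e where e: "e \<in> carrier R" "e \<otimes> \<delta> = \<one>"
      using \<delta> units by (auto simp: Units_def)
    \<comment> \<open>The only possible coefficient of \<open>c\<close>, by \<open>f_diff\<close>;
      here \<open>e\<close> is the inverse of \<delta>.\<close>
    define t where "t = (d \<ominus> \<theta> d) \<otimes> e"
    have t: "t \<in> carrier R"
      using d e by (simp add: t_def)
    have t\<delta>: "t \<otimes> \<delta> = d \<ominus> \<theta> d"
      using d e \<delta> by (simp add: t_def m_assoc)
    \<comment> \<open>Both \<open>d - \<theta> d\<close> and \<delta> change sign under \<theta>, so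
      their quotient \<open>t\<close> is fixed.\<close>
    have "\<ominus> (\<theta> t \<otimes> \<delta>) = \<theta> (t \<otimes> \<delta>)"
      using t \<delta> by (simp add: mult \<theta>\<delta> l_minus m_comm[of "\<theta> t" \<delta>])
    also have "\<dots> = \<theta> d \<ominus> d"
      using d by (simp add: t\<delta> minus invol)
    also have "\<dots> = \<ominus> (t \<otimes> \<delta>)"
      using d by (simp add: t\<delta> minus_eq minus_add a_comm)
    finally have "\<theta> t \<otimes> \<delta> = t \<otimes> \<delta>"
      using t \<delta> by (metis closed m_closed minus_minus)
    then have \<theta>t: "\<theta> t = t"
      using t \<delta> m_rcancel by (metis closed)
    define s where "s = d \<ominus> t \<otimes> c"
    have s: "s \<in> carrier R"
      using d t c by (simp add: s_def)
    have "d \<ominus> \<theta> d = t \<otimes> (c \<ominus> \<theta> c)"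
      using t\<delta> by (simp add: \<delta>_def)
    then have "\<theta> d \<ominus> t \<otimes> \<theta> c = s"
      using d t c unfolding s_def by (intro diff_mult_eq_diff_mult) auto
    then have "\<theta> s = s"
      using d t c by (simp add: s_def minus mult \<theta>t m_comm)
    then have "(s, t) \<in> T \<times> T"
      using s t \<theta>t by (simp add: T_def)
    moreover have "d = s \<oplus> t \<otimes> c"
      using d t c by (simp add: s_def diff_add_cancel)
    ultimately show "d \<in> ?f ` (T \<times> T)"
      by (intro image_eqI[of _ ?f "(s, t)"]) auto
  qed
  ultimately have "card (T \<times> T) = card (carrier R)"
    by (metis card_image)
  then show ?thesis
    by (simp add: card_cartesian_product power2_eq_square)
qed simp

end

section \<open>Adjoints with respect to a symmetric pairing\<close>

text \<open>Functions are normalised outside the carrier, so that endomorphisms agreeing on the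
  carrier are equal and can be counted.\<close>

definition endo_ring :: "('a, 'm) monoid_scheme \<Rightarrow> ('a \<Rightarrow> 'a) ring" where
  "endo_ring A =
     \<lparr>carrier = hom A A \<inter> extensional (carrier A),
      monoid.mult = compose (carrier A), one = (\<lambda>x\<in>carrier A. x),
      ring.zero = (\<lambda>x\<in>carrier A. \<one>\<^bsub>A\<^esub>), ring.add = (\<lambda>f g. \<lambda>x\<in>carrier A. f x \<otimes>\<^bsub>A\<^esub> g x)\<rparr>"

lemma carrier_endo_ring: "f \<in> carrier (endo_ring A) \<longleftrightarrow> f \<in> hom A A \<and> f \<in> extensional (carrier A)"
  by (simp add: endo_ring_def)

lemma endo_ring_simps [simp]:
  "x \<in> carrier A \<Longrightarrow> (f \<otimes>\<^bsub>endo_ring A\<^esub> g) x = f (g x)"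
  "x \<in> carrier A \<Longrightarrow> \<one>\<^bsub>endo_ring A\<^esub> x = x"
  "x \<in> carrier A \<Longrightarrow> \<zero>\<^bsub>endo_ring A\<^esub> x = \<one>\<^bsub>A\<^esub>"
  "x \<in> carrier A \<Longrightarrow> (f \<oplus>\<^bsub>endo_ring A\<^esub> g) x = f x \<otimes>\<^bsub>A\<^esub> g x"
  by (auto simp: endo_ring_def compose_def)

lemma endo_ring_ext:
  assumes "f \<in> carrier (endo_ring A)" and "g \<in> carrier (endo_ring A)"
    and "\<And>x. x \<in> carrier A \<Longrightarrow> f x = g x"
  shows "f = g"
  using assms by (auto simp: endo_ring_def intro: extensionalityI)

lemma (in comm_group) ring_endo_ring: "ring (endo_ring G)"
proof -
  let ?E = "endo_ring G"
  note ext = endo_ring_ext[where A = G]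
  have closed: "f x \<in> carrier G" if "f \<in> carrier ?E" "x \<in> carrier G" for f x
    using that by (auto simp: carrier_endo_ring hom_def)
  have distr: "f (x \<otimes> y) = f x \<otimes> f y" if "f \<in> carrier ?E" "x \<in> carrier G" "y \<in> carrier G" for f x y
    using that by (auto simp: carrier_endo_ring hom_def)
  have add [intro]: "f \<oplus>\<^bsub>?E\<^esub> g \<in> carrier ?E" if "f \<in> carrier ?E" "g \<in> carrier ?E" for f g
  proof -
    have "(\<lambda>x\<in>carrier G. f x \<otimes> g x) \<in> hom G G"
      by (rule homI) (simp_all add: that closed distr m_ac)
    then show ?thesis
      by (simp add: endo_ring_def)
  qed
  have mult [intro]: "f \<otimes>\<^bsub>?E\<^esub> g \<in> carrier ?E" if "f \<in> carrier ?E" "g \<in> carrier ?E" for f g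
  proof -
    have "compose (carrier G) f g \<in> hom G G"
      by (rule homI) (simp_all add: that closed distr compose_def)
    then show ?thesis
      by (simp add: endo_ring_def)
  qed
  have zero [intro]: "\<zero>\<^bsub>?E\<^esub> \<in> carrier ?E"
    by (auto simp: endo_ring_def hom_def)
  have one [intro]: "\<one>\<^bsub>?E\<^esub> \<in> carrier ?E"
    by (auto simp: endo_ring_def hom_def)
  show ?thesis
  proof (intro ringI abelian_groupI monoidI)
    show "\<exists>g\<in>carrier ?E. g \<oplus>\<^bsub>?E\<^esub> f = \<zero>\<^bsub>?E\<^esub>" if f: "f \<in> carrier ?E" for f
    proof
      show g: "(\<lambda>x\<in>carrier G. inv (f x)) \<in> carrier ?E"
      proof -
        have "(\<lambda>x\<in>carrier G. inv (f x)) \<in> hom G G"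
          by (rule homI) (simp_all add: f closed distr inv_mult)
        then show ?thesis
          by (simp add: endo_ring_def)
      qed
      show "(\<lambda>x\<in>carrier G. inv (f x)) \<oplus>\<^bsub>?E\<^esub> f = \<zero>\<^bsub>?E\<^esub>"
        using closed[OF f] by (intro ext add zero f g) auto
    qed
  qed (auto simp: closed distr m_ac intro!: ext)
qed

text \<open>Symmetry turns the one-sided axioms into two-sided ones. The values lie in an abelian
  group rather than a field, because commutators will take values in the center of
  \<open>G\<close>.\<close>

locale symmetric_pairing = A: comm_group A + W: comm_group W
  for A :: "('a, 'm) monoid_scheme" and W :: "('b, 'n) monoid_scheme" +
  fixes g :: "'a \<Rightarrow> 'a \<Rightarrow> 'b"
  assumes closed [simp]: "u \<in> carrier A \<Longrightarrow> x \<in> carrier A \<Longrightarrow> g u x \<in> carrier W"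
    and mult_right: "u \<in> carrier A \<Longrightarrow> x \<in> carrier A \<Longrightarrow> y \<in> carrier A \<Longrightarrow>
      g u (x \<otimes>\<^bsub>A\<^esub> y) = g u x \<otimes>\<^bsub>W\<^esub> g u y"
    and sym: "u \<in> carrier A \<Longrightarrow> x \<in> carrier A \<Longrightarrow> g u x = g x u"
    and nondegenerate: "u \<in> carrier A \<Longrightarrow> (\<And>x. x \<in> carrier A \<Longrightarrow> g u x = \<one>\<^bsub>W\<^esub>) \<Longrightarrow> u = \<one>\<^bsub>A\<^esub>"
begin

abbreviation E where "E \<equiv> endo_ring A"

definition adj :: "('a \<Rightarrow> 'a) \<Rightarrow> ('a \<Rightarrow> 'a) \<Rightarrow> bool" where
  "adj f h \<longleftrightarrow> (\<forall>u\<in>carrier A. \<forall>x\<in>carrier A. g u (f x) = g (h u) x)"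

text \<open>As \<open>W\<close> need not be cyclic, the pairing need not identify \<open>A\<close>
  with its dual, and the existence of an adjoint is a genuine condition.\<close>

definition adjointable :: "('a \<Rightarrow> 'a) set" where
  "adjointable = {f \<in> carrier E. \<exists>h\<in>carrier E. adj f h}"

text \<open>The adjoint is unique by nondegeneracy; the description is meaningful on
  \<open>adjointable\<close> only.\<close>

definition star :: "('a \<Rightarrow> 'a) \<Rightarrow> 'a \<Rightarrow> 'a" where
  "star f = (THE h. h \<in> carrier E \<and> adj f h)"

sublocale E: ring E
  by (rule A.ring_endo_ring)

lemma endo_closed [simp]: "f \<in> carrier E \<Longrightarrow> x \<in> carrier A \<Longrightarrow> f x \<in> carrier A"
  by (auto simp: carrier_endo_ring hom_def)

lemma mult_left:
  assumes "u \<in> carrier A" and "v \<in> carrier A" and "x \<in> carrier A"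
  shows "g (u \<otimes>\<^bsub>A\<^esub> v) x = g u x \<otimes>\<^bsub>W\<^esub> g v x"
  using assms sym mult_right by (metis A.m_closed)

lemma one_right [simp]: "u \<in> carrier A \<Longrightarrow> g u \<one>\<^bsub>A\<^esub> = \<one>\<^bsub>W\<^esub>"
  using mult_right[of u "\<one>\<^bsub>A\<^esub>" "\<one>\<^bsub>A\<^esub>"] by (simp add: W.l_cancel_one')

lemma one_left [simp]: "u \<in> carrier A \<Longrightarrow> g \<one>\<^bsub>A\<^esub> u = \<one>\<^bsub>W\<^esub>"
  using sym one_right by (metis A.one_closed)

lemma inv_right: "u \<in> carrier A \<Longrightarrow> x \<in> carrier A \<Longrightarrow> g u (inv\<^bsub>A\<^esub> x) = inv\<^bsub>W\<^esub> (g u x)"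
  using mult_right[of u "inv\<^bsub>A\<^esub> x" x] by (intro W.inv_equality[symmetric]) auto

lemma inv_left: "u \<in> carrier A \<Longrightarrow> x \<in> carrier A \<Longrightarrow> g (inv\<^bsub>A\<^esub> u) x = inv\<^bsub>W\<^esub> (g u x)"
  using sym inv_right by (metis A.inv_closed)

lemma left_eqI:
  assumes "u \<in> carrier A" and "v \<in> carrier A" and "\<And>x. x \<in> carrier A \<Longrightarrow> g u x = g v x"
  shows "u = v"
proof -
  have "u \<otimes>\<^bsub>A\<^esub> inv\<^bsub>A\<^esub> v = \<one>\<^bsub>A\<^esub>"
    using assms by (intro nondegenerate) (auto simp: mult_left inv_left)
  then show ?thesis
    using assms(1,2) by (metis A.inv_equality A.inv_inv A.inv_closed)
qed

lemma adj_sym: "f \<in> carrier E \<Longrightarrow> h \<in> carrier E \<Longrightarrow> adj f h \<Longrightarrow> adj h f"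
  unfolding adj_def using sym by (metis endo_closed)

lemma adj_unique:
  assumes "h \<in> carrier E" and "h' \<in> carrier E" and "adj f h" and "adj f h'"
  shows "h = h'"
proof (rule endo_ring_ext[where A = A])
  fix u assume "u \<in> carrier A"
  then show "h u = h' u"
    using assms by (intro left_eqI) (auto simp: adj_def)
qed (use assms in auto)

lemma star_eqI: "h \<in> carrier E \<Longrightarrow> adj f h \<Longrightarrow> star f = h"
  unfolding star_def by (rule the_equality) (use adj_unique in blast)+

lemma adjointable_subset: "f \<in> adjointable \<Longrightarrow> f \<in> carrier E"
  by (simp add: adjointable_def)

lemma star:
  assumes "f \<in> adjointable"
  shows "star f \<in> carrier E" and "adj f (star f)" and "star f \<in> adjointable"
proof -
  obtain h where h: "h \<in> carrier E" "adj f h"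
    using assms unfolding adjointable_def by blast
  then have "star f = h"
    by (rule star_eqI)
  with h show "star f \<in> carrier E" "adj f (star f)"
    by auto
  then show "star f \<in> adjointable"
    using adj_sym assms unfolding adjointable_def by blast
qed

lemma adj_add:
  assumes "f \<in> carrier E" "f' \<in> carrier E" "h \<in> carrier E" "h' \<in> carrier E" "adj f h" "adj f' h'"
  shows "adj (f \<oplus>\<^bsub>E\<^esub> f') (h \<oplus>\<^bsub>E\<^esub> h')"
  using assms by (simp add: adj_def mult_left mult_right)

lemma adj_mult:
  assumes "f \<in> carrier E" "f' \<in> carrier E" "h \<in> carrier E" "h' \<in> carrier E" "adj f h" "adj f' h'"
  shows "adj (f \<otimes>\<^bsub>E\<^esub> f') (h' \<otimes>\<^bsub>E\<^esub> h)"
  using assms by (simp add: adj_def)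

lemma minus_apply:
  assumes "f \<in> carrier E" and "x \<in> carrier A"
  shows "(\<ominus>\<^bsub>E\<^esub> f) x = inv\<^bsub>A\<^esub> (f x)"
proof -
  have "(\<ominus>\<^bsub>E\<^esub> f) x \<otimes>\<^bsub>A\<^esub> f x = \<one>\<^bsub>A\<^esub>"
    using E.l_neg[OF assms(1)] assms(2) by (metis endo_ring_simps(3,4))
  then show ?thesis
    by (rule A.inv_equality[symmetric, OF _ endo_closed[OF assms]
        endo_closed[OF E.a_inv_closed[OF assms(1)] assms(2)]])
qed

lemma adj_minus:
  assumes "f \<in> carrier E" "h \<in> carrier E" "adj f h"
  shows "adj (\<ominus>\<^bsub>E\<^esub> f) (\<ominus>\<^bsub>E\<^esub> h)"
  using assms by (simp add: adj_def minus_apply inv_left inv_right)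

lemma subring_adjointable: "subring adjointable E"
proof (rule E.subringI)
  have "adj \<one>\<^bsub>E\<^esub> \<one>\<^bsub>E\<^esub>"
    by (simp add: adj_def)
  then show "\<one>\<^bsub>E\<^esub> \<in> adjointable"
    unfolding adjointable_def by blast
  show "\<ominus>\<^bsub>E\<^esub> f \<in> adjointable" if "f \<in> adjointable" for f
    using that adj_minus unfolding adjointable_def by blast
  show "f \<otimes>\<^bsub>E\<^esub> h \<in> adjointable" if "f \<in> adjointable" "h \<in> adjointable" for f h
    using that adj_mult unfolding adjointable_def by blast
  show "f \<oplus>\<^bsub>E\<^esub> h \<in> adjointable" if "f \<in> adjointable" "h \<in> adjointable" for f h
    using that adj_add unfolding adjointable_def by blast
qed (use adjointable_subset in blast)

lemma self_adjoint_iff: "f \<in> adjointable \<Longrightarrow> adj f f \<longleftrightarrow> star f = f"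
  using star star_eqI adjointable_subset by metis

text \<open>Injectivity of the nonzero elements excludes zero divisors, so
  \<open>adjointable\<close> is a finite skew field on which \<open>star\<close> is an involutive
  anti-automorphism. Its additive group has exponent dividing \<open>p\<close>, which gives the
  order \<open>p^a\<close>, and \<open>A\<close> is a module over it.\<close>

theorem card_adjointable:
  assumes fin: "finite (carrier A)" and "carrier A \<noteq> {\<one>\<^bsub>A\<^esub>}"
    and p: "Factorial_Ring.prime p"
    and exp: "\<And>x. x \<in> carrier A \<Longrightarrow> x [^]\<^bsub>A\<^esub> (p::nat) = \<one>\<^bsub>A\<^esub>"
    and inj: "\<And>f. f \<in> adjointable \<Longrightarrow> f \<noteq> \<zero>\<^bsub>E\<^esub> \<Longrightarrow> inj_on f (carrier A)"
  obtains a b k where "a > 0" "b > 0" "card adjointable = p ^ a"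
    "card {f \<in> adjointable. adj f f} = p ^ b" "a = b \<or> a = 2 * b" "card (carrier A) = p ^ (a * k)"
proof -
  let ?R = "E\<lparr>carrier := adjointable\<rparr>"
  let ?T = "{f \<in> adjointable. adj f f}"
  interpret R: ring ?R
    using E.subring_is_ring[OF subring_adjointable] .
  have "carrier E \<subseteq> carrier A \<rightarrow>\<^sub>E carrier A"
  proof
    fix f assume "f \<in> carrier E"
    then have "f \<in> carrier A \<rightarrow> carrier A" "f \<in> extensional (carrier A)"
      unfolding carrier_endo_ring hom_def by blast+
    then show "f \<in> carrier A \<rightarrow>\<^sub>E carrier A"
      unfolding PiE_def by blast
  qed
  then have "finite (carrier E)"
    using fin by (meson finite_PiE finite_subset)
  moreover have "adjointable \<subseteq> carrier E"
    by (auto simp: adjointable_def)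
  ultimately have finR: "finite adjointable"
    by (rule finite_subset[rotated])
  obtain x where x: "x \<in> carrier A" "x \<noteq> \<one>\<^bsub>A\<^esub>"
    using assms(2) A.one_closed by blast
  have one_neq_zero: "\<one>\<^bsub>E\<^esub> \<noteq> \<zero>\<^bsub>E\<^esub>"
    using x by (metis endo_ring_simps(2,3))
  have units: "Units ?R = carrier ?R - {\<zero>\<^bsub>?R\<^esub>}"
  proof (rule R.finite_Units_if_no_zero_divisors)
    fix f h assume "f \<in> carrier ?R" "h \<in> carrier ?R" "f \<otimes>\<^bsub>?R\<^esub> h = \<zero>\<^bsub>?R\<^esub>"
    then have f: "f \<in> adjointable" "f \<in> carrier E" and h: "h \<in> carrier E" and fh: "f \<otimes>\<^bsub>E\<^esub> h = \<zero>\<^bsub>E\<^esub>"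
      using adjointable_subset by auto
    show "f = \<zero>\<^bsub>?R\<^esub> \<or> h = \<zero>\<^bsub>?R\<^esub>"
    proof (rule disjCI)
      assume "h \<noteq> \<zero>\<^bsub>?R\<^esub>"
      then have "h \<noteq> \<zero>\<^bsub>E\<^esub>"
        by simp
      then obtain y where y: "y \<in> carrier A" "h y \<noteq> \<zero>\<^bsub>E\<^esub> y"
        using endo_ring_ext[OF h E.zero_closed] by blast
      \<comment> \<open>Thus \<open>f\<close> kills the nontrivial element \<open>h y\<close>, so it
        is not injective and must be zero.\<close>
      then have "f (h y) = \<one>\<^bsub>A\<^esub>"
        using fh by (metis endo_ring_simps(1,3))
      also have "\<dots> = f \<one>\<^bsub>A\<^esub>"
        using hom_one[OF _ A.is_group A.is_group, of f] f(2) by (simp add: carrier_endo_ring)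
      finally have "\<not> inj_on f (carrier A)"
        using y h by (metis A.one_closed endo_closed endo_ring_simps(3) inj_onD)
      then show "f = \<zero>\<^bsub>?R\<^esub>"
        using inj f by auto
    qed
  qed (use finR one_neq_zero in auto)
  have T_eq: "?T = {f \<in> carrier ?R. star f = f}"
    using self_adjoint_iff by auto
  have card_T: "card ?T = card adjointable \<or> (card ?T)\<^sup>2 = card adjointable"
  proof -
    have "star (f \<oplus>\<^bsub>E\<^esub> h) = star f \<oplus>\<^bsub>E\<^esub> star h" "star (f \<otimes>\<^bsub>E\<^esub> h) = star h \<otimes>\<^bsub>E\<^esub> star f"
      if "f \<in> adjointable" "h \<in> adjointable" for f h
      using star(1,2)[OF that(1)] star(1,2)[OF that(2)] adjointable_subset that
        adj_add[of f h "star f" "star h"] adj_mult[of f h "star f" "star h"]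
      by (intro star_eqI E.add.m_closed E.m_closed; blast)+
    moreover have "star (star f) = f" if "f \<in> adjointable" for f
      using star[OF that] adjointable_subset[OF that] adj_sym by (intro star_eqI)
    ultimately show ?thesis
      unfolding T_eq using R.card_fixed_points_involution[of star] finR units star(3) by simp
  qed
  have add_group: "group (add_monoid ?R)"
    using R.a_comm_group by (rule comm_group.axioms)
  \<comment> \<open>Multiples in the additive group of endomorphisms are pointwise powers, so the
    exponent condition on \<open>A\<close> carries over.\<close>
  have pow: "(f [^]\<^bsub>add_monoid ?R\<^esub> (n::nat)) x = f x [^]\<^bsub>A\<^esub> n" if "x \<in> carrier A" for f x n
    using that by (induction n) auto
  have "\<exists>a. Coset.order (add_monoid ?R) = p ^ a"
  proof (rule group.order_prime_power_if_exponent[OF add_group])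
    fix f assume f: "f \<in> carrier (add_monoid ?R)"
    have "f [^]\<^bsub>add_monoid ?R\<^esub> p \<in> carrier (add_monoid ?R)"
      using f by (rule monoid.nat_pow_closed[OF group.is_monoid[OF add_group]])
    then have "f [^]\<^bsub>add_monoid ?R\<^esub> p = \<zero>\<^bsub>E\<^esub>"
      using f adjointable_subset pow exp by (intro endo_ring_ext[where A = A]) auto
    then show "f [^]\<^bsub>add_monoid ?R\<^esub> p = \<one>\<^bsub>add_monoid ?R\<^esub>"
      by simp
  qed (use finR p in auto)
  then obtain a where a: "card adjointable = p ^ a"
    by (auto simp: Coset.order_def)
  \<comment> \<open>Two distinct elements force \<open>a > 0\<close>; then \<open>b > 0\<close>
    follows from \<open>a = b \<or> a = 2 * b\<close>.\<close>
  have "{\<zero>\<^bsub>E\<^esub>, \<one>\<^bsub>E\<^esub>} \<subseteq> adjointable"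
    using subringE(2,3)[OF subring_adjointable] by blast
  then have "card {\<zero>\<^bsub>E\<^esub>, \<one>\<^bsub>E\<^esub>} \<le> card adjointable"
    using finR by (rule card_mono[rotated])
  then have "a \<noteq> 0"
    using one_neq_zero a by (intro notI) simp
  obtain k where "card (carrier A) = card (carrier ?R) ^ k"
  proof (rule card_skew_field_module[where act = "\<lambda>f. f"])
    show "ring ?R"
      by unfold_locales
    show "f \<in> hom A A" if "f \<in> carrier ?R" for f
      using that adjointable_subset carrier_endo_ring by force
  qed (use finR fin units A.comm_group_axioms in auto)
  then have k: "card (carrier A) = p ^ (a * k)"
    by (simp add: a power_mult)
  obtain b where "card ?T = p ^ b" "a = b \<or> a = 2 * b"
    using card_T
  proof
    assume "(card ?T)\<^sup>2 = card adjointable"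
    then have sq: "(card ?T)\<^sup>2 = p ^ a"
      using a by simp
    then have "card ?T dvd p ^ a"
      by (metis dvd_power zero_less_numeral)
    then obtain b where b: "card ?T = p ^ b"
      using divides_primepow_nat[OF p] by blast
    then have "p ^ (2 * b) = p ^ a"
      using sq by (simp add: power_mult mult.commute[of 2])
    then have "a = 2 * b"
      using prime_gt_1_nat[OF p] by (metis power_inject_exp)
    with b show thesis
      using that by blast
  qed (use a that in auto)
  with a k \<open>a \<noteq> 0\<close> show thesis
    by (intro that[of a b k]) auto
qed

end

section \<open>Alternating forms\<close>

locale alternating_form = V: comm_group V + W: comm_group W
  for V :: "('a, 'm) monoid_scheme" (structure) and W :: "('b, 'n) monoid_scheme" +
  fixes \<kappa> :: "'a \<Rightarrow> 'a \<Rightarrow> 'b"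
  assumes finite_carrier: "finite (carrier V)"
    and closed [simp]: "x \<in> carrier V \<Longrightarrow> y \<in> carrier V \<Longrightarrow> \<kappa> x y \<in> carrier W"
    and mult_left: "x \<in> carrier V \<Longrightarrow> y \<in> carrier V \<Longrightarrow> z \<in> carrier V \<Longrightarrow>
      \<kappa> (x \<otimes> y) z = \<kappa> x z \<otimes>\<^bsub>W\<^esub> \<kappa> y z"
    and mult_right: "x \<in> carrier V \<Longrightarrow> y \<in> carrier V \<Longrightarrow> z \<in> carrier V \<Longrightarrow>
      \<kappa> x (y \<otimes> z) = \<kappa> x y \<otimes>\<^bsub>W\<^esub> \<kappa> x z"
    and alternating: "x \<in> carrier V \<Longrightarrow> \<kappa> x x = \<one>\<^bsub>W\<^esub>"
begin

definition perp :: "'a set \<Rightarrow> 'a set" where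
  "perp U = {v \<in> carrier V. \<forall>u\<in>U. \<kappa> v u = \<one>\<^bsub>W\<^esub>}"

text \<open>The cardinality equation expresses maximal Chermak-Delgado measure, divided by
  \<open>|Z(G)|^2\<close>. The two excluded subgroups correspond to the bottom \<open>Z(G)\<close>
  and the top \<open>G\<close> of the lattice.\<close>

definition cd_atoms :: "'a set set" where
  "cd_atoms = {U. subgroup U V \<and> card U * card (perp U) = card (carrier V) \<and>
     U \<noteq> {\<one>} \<and> U \<noteq> carrier V}"

lemma skew:
  assumes "x \<in> carrier V" and "y \<in> carrier V"
  shows "\<kappa> y x = inv\<^bsub>W\<^esub> (\<kappa> x y)"
proof -
  have "\<one>\<^bsub>W\<^esub> = \<kappa> (y \<otimes> x) (y \<otimes> x)"
    using assms by (simp add: alternating)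
  also have "\<dots> = \<kappa> y x \<otimes>\<^bsub>W\<^esub> \<kappa> x y"
    using assms by (simp add: mult_left mult_right alternating[OF assms(1)] alternating[OF assms(2)] W.m_comm)
  finally show ?thesis
    using assms by (intro W.inv_equality[symmetric]) auto
qed

lemma one_left [simp]: "x \<in> carrier V \<Longrightarrow> \<kappa> \<one> x = \<one>\<^bsub>W\<^esub>"
  using mult_left[of \<one> \<one> x] by (simp add: W.l_cancel_one')

lemma orthogonal_sym: "x \<in> carrier V \<Longrightarrow> y \<in> carrier V \<Longrightarrow> \<kappa> x y = \<one>\<^bsub>W\<^esub> \<Longrightarrow> \<kappa> y x = \<one>\<^bsub>W\<^esub>"
  by (simp add: skew[of x y])

lemma inv_left: "x \<in> carrier V \<Longrightarrow> y \<in> carrier V \<Longrightarrow> \<kappa> (inv x) y = inv\<^bsub>W\<^esub> (\<kappa> x y)"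
  using mult_left[of "inv x" x y] by (intro W.inv_equality[symmetric]) auto

lemma subgroup_perp:
  assumes "U \<subseteq> carrier V"
  shows "subgroup (perp U) V"
proof (rule V.subgroupI)
  show "perp U \<noteq> {}"
    using assms by (auto simp: perp_def intro!: exI[of _ \<one>])
qed (use assms in \<open>auto simp: perp_def mult_left inv_left subset_iff\<close>)

lemma perp_subset: "perp U \<subseteq> carrier V"
  by (auto simp: perp_def)

lemma subset_perp_perp: "U \<subseteq> carrier V \<Longrightarrow> U \<subseteq> perp (perp U)"
  using orthogonal_sym by (auto simp: perp_def subset_iff)

end

section \<open>Alternating forms whose atoms are pairwise complementary\<close>

locale quasi_antichain_form = alternating_form +
  assumes maximal: "subgroup U V \<Longrightarrow> card U * card (perp U) \<le> card (carrier V)"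
    and atoms_disjoint: "U \<in> cd_atoms \<Longrightarrow> U' \<in> cd_atoms \<Longrightarrow> U \<noteq> U' \<Longrightarrow> U \<inter> U' = {\<one>}"
    and atoms_span: "U \<in> cd_atoms \<Longrightarrow> U' \<in> cd_atoms \<Longrightarrow> U \<noteq> U' \<Longrightarrow> U <#> U' = carrier V"
    and atoms_card: "U \<in> cd_atoms \<Longrightarrow> U' \<in> cd_atoms \<Longrightarrow> card U = card U'"
begin

lemma atom_subgroup: "U \<in> cd_atoms \<Longrightarrow> subgroup U V"
  by (simp add: cd_atoms_def)

lemma atom_subset: "U \<in> cd_atoms \<Longrightarrow> U \<subseteq> carrier V"
  using atom_subgroup subgroup.subset by blast

lemma atom_finite: "U \<in> cd_atoms \<Longrightarrow> finite U"
  using atom_subset finite_carrier finite_subset by metis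

lemma carrier_pos: "card (carrier V) > 0"
  using finite_carrier card_gt_0_iff V.one_closed by blast

text \<open>Since \<open>U \<subseteq> perp (perp U)\<close>, the product for \<open>perp U\<close>
  is at least the one for \<open>U\<close>, and \<open>maximal\<close> forces equality.\<close>

lemma perp_atom:
  assumes U: "U \<in> cd_atoms"
  shows "perp U \<in> cd_atoms"
proof -
  have sub: "subgroup (perp U) V"
    using subgroup_perp atom_subset[OF U] by blast
  have eq: "card U * card (perp U) = card (carrier V)"
    using U by (simp add: cd_atoms_def)
  have "finite (perp (perp U))"
    using perp_subset finite_carrier finite_subset by metis
  then have "card U \<le> card (perp (perp U))"
    using subset_perp_perp[OF atom_subset[OF U]] card_mono by blast
  then have "card (carrier V) \<le> card (perp U) * card (perp (perp U))"
    unfolding eq[symmetric] by (simp add: mult.commute)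
  then have "card (perp U) * card (perp (perp U)) = card (carrier V)"
    using maximal[OF sub] by simp
  moreover have "perp U \<noteq> {\<one>}"
  proof
    assume "perp U = {\<one>}"
    then have "card U = card (carrier V)"
      using eq by simp
    then have "U = carrier V"
      using card_subset_eq[OF finite_carrier atom_subset[OF U]] by simp
    then show False
      using U by (simp add: cd_atoms_def)
  qed
  moreover have "perp U \<noteq> carrier V"
  proof
    assume "perp U = carrier V"
    then have "card U = 1"
      using eq carrier_pos by simp
    then have "U = {\<one>}"
      using subgroup.one_closed[OF atom_subgroup[OF U]] by (metis card_1_singletonE singletonD)
    then show False
      using U by (simp add: cd_atoms_def)
  qed
  ultimately show ?thesis
    using sub by (simp add: cd_atoms_def)
qed

text \<open>\<open>perp U\<close> is an atom too, and all atoms have the same order.\<close>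

lemma card_atom_square:
  assumes "U \<in> cd_atoms"
  shows "card U * card U = card (carrier V)"
proof -
  have "card (perp U) = card U"
    using atoms_card perp_atom assms by blast
  then show ?thesis
    using assms unfolding cd_atoms_def by auto
qed

lemma isotropic_atom_perp:
  assumes "U \<in> cd_atoms" and "U \<subseteq> perp U"
  shows "perp U = U"
proof -
  have "U = perp U"
    using atom_finite[OF perp_atom[OF assms(1)]] assms(2)
      atoms_card[OF assms(1) perp_atom[OF assms(1)]] by (rule card_subset_eq)
  then show ?thesis
    by simp
qed

lemma card_atom_gt_1:
  assumes "U \<in> cd_atoms"
  shows "card U > 1"
proof -
  have "card U \<noteq> 1"
  proof
    assume "card U = 1"
    then obtain x where "U = {x}"
      by (rule card_1_singletonE)
    moreover have "\<one> \<in> U"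
      using subgroup.one_closed[OF atom_subgroup[OF assms]] .
    ultimately show False
      using assms by (simp add: cd_atoms_def)
  qed
  moreover have "card U \<noteq> 0"
    using card_atom_square[OF assms] carrier_pos by (metis mult_0 less_irrefl)
  ultimately show ?thesis
    by linarith
qed

text \<open>The inclusion \<open>K \<subseteq> perp H\<close> already brings
  \<open>|H| |perp H|\<close> up to \<open>|V|\<close>, the largest value allowed by
  \<open>maximal\<close>.\<close>

lemma atomI:
  assumes U: "U \<in> cd_atoms" and H: "subgroup H V" "card H = card U"
    and K: "K \<subseteq> perp H" "card K = card U"
  shows "H \<in> cd_atoms"
proof -
  have "card K \<le> card (perp H)"
    using K(1) perp_subset finite_carrier finite_subset card_mono by metis
  then have "card (carrier V) \<le> card H * card (perp H)"
    using card_atom_square[OF U] H(2) K(2) by (metis mult_le_mono2)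
  then have "card H * card (perp H) = card (carrier V)"
    using maximal[OF H(1)] by simp
  moreover have "card H \<noteq> card {\<one>}" "card H \<noteq> card (carrier V)"
    using card_atom_gt_1[OF U] card_atom_square[OF U] H(2) by auto
  ultimately show ?thesis
    using H(1) unfolding cd_atoms_def by blast
qed

end

section \<open>Coordinates given by three isotropic atoms\<close>

locale isotropic_frame = quasi_antichain_form +
  fixes A B C
  assumes A: "A \<in> cd_atoms" and B: "B \<in> cd_atoms" and C: "C \<in> cd_atoms"
    and distinct: "A \<noteq> B" "B \<noteq> C" "A \<noteq> C"
    and isotropic: "A \<subseteq> perp A" "B \<subseteq> perp B" "C \<subseteq> perp C"
begin

lemma A_closed [simp]: "x \<in> A \<Longrightarrow> x \<in> carrier V"
  and B_closed [simp]: "y \<in> B \<Longrightarrow> y \<in> carrier V"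
  using A B atom_subset by blast+

text \<open>The element \<open>inv x' \<otimes> x = y' \<otimes> inv y\<close> lies in both
  \<open>A\<close> and \<open>B\<close>, hence is trivial.\<close>

lemma AB_unique:
  assumes "x \<in> A" "x' \<in> A" "y \<in> B" "y' \<in> B" and eq: "x \<otimes> y = x' \<otimes> y'"
  shows "x = x'" and "y = y'"
proof -
  have "inv x' \<otimes> x = y' \<otimes> inv y"
  proof -
    have "inv x' \<otimes> x = inv x' \<otimes> (x \<otimes> y) \<otimes> inv y"
      using assms(1-4) by (simp add: V.m_assoc)
    also have "\<dots> = y' \<otimes> inv y"
      unfolding eq using assms(1-4) by (simp add: V.m_assoc[symmetric])
    finally show ?thesis .
  qed
  moreover have "inv x' \<otimes> x \<in> A" "y' \<otimes> inv y \<in> B"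
    using assms atom_subgroup[OF A] atom_subgroup[OF B]
    by (auto intro: subgroup.m_closed subgroup.m_inv_closed)
  ultimately have "inv x' \<otimes> x = \<one>"
    using atoms_disjoint[OF A B distinct(1)] by auto
  then show "x = x'"
    using assms by (metis V.inv_equality V.inv_inv V.inv_closed A_closed)
  with eq show "y = y'"
    using assms by simp
qed

text \<open>Existence comes from \<open>U <#> B = carrier V\<close>, uniqueness from the trivial
  intersection of \<open>U\<close> and \<open>B\<close>.\<close>

lemma slope_exists:
  assumes U: "U \<in> cd_atoms" "U \<noteq> B" and x: "x \<in> A"
  shows "\<exists>!y. y \<in> B \<and> x \<otimes> y \<in> U"
proof (rule ex_ex1I)
  have "x \<in> U <#> B"
    using atoms_span[OF U(1) B U(2)] x by simp
  then obtain u b where ub: "u \<in> U" "b \<in> B" "x = u \<otimes> b"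
    by (auto simp: set_mult_def)
  have "u \<in> carrier V"
    using ub U atom_subset by blast
  then have "x \<otimes> inv b = u"
    using ub by (simp add: V.m_assoc)
  moreover have "inv b \<in> B"
    using ub atom_subgroup[OF B] by (simp add: subgroup.m_inv_closed)
  ultimately show "\<exists>y. y \<in> B \<and> x \<otimes> y \<in> U"
    using ub by blast
next
  fix y y' assume y: "y \<in> B \<and> x \<otimes> y \<in> U" "y' \<in> B \<and> x \<otimes> y' \<in> U"
  have "inv (x \<otimes> y) \<otimes> (x \<otimes> y') \<in> U"
    using y atom_subgroup[OF U(1)] by (simp add: subgroup.m_inv_closed subgroup.m_closed)
  also have "inv (x \<otimes> y) \<otimes> (x \<otimes> y') = inv y \<otimes> (inv x \<otimes> x) \<otimes> y'"
    using x y by (simp add: V.inv_mult_group V.m_assoc del: V.l_inv V.Units_l_inv)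
  also have "\<dots> = inv y \<otimes> y'"
    using x y by simp
  finally have "inv y \<otimes> y' \<in> U" .
  moreover have "inv y \<otimes> y' \<in> B"
    using y atom_subgroup[OF B] by (simp add: subgroup.m_inv_closed subgroup.m_closed)
  ultimately have "inv y \<otimes> y' = \<one>"
    using atoms_disjoint[OF U(1) B U(2)] by blast
  then show "y = y'"
    using y by (metis V.inv_equality V.inv_inv V.inv_closed B_closed)
qed

text \<open>The map from \<open>A\<close> to \<open>B\<close> whose graph is \<open>U\<close>, for
  an atom \<open>U\<close> other than \<open>B\<close>.\<close>

definition slope :: "'a set \<Rightarrow> 'a \<Rightarrow> 'a" where
  "slope U x = (THE y. y \<in> B \<and> x \<otimes> y \<in> U)"

lemma slope:
  assumes "U \<in> cd_atoms" "U \<noteq> B" "x \<in> A"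
  shows "slope U x \<in> B" and "x \<otimes> slope U x \<in> U"
  using theI'[OF slope_exists[OF assms]] by (auto simp: slope_def)

lemma slope_eqI:
  assumes "U \<in> cd_atoms" "U \<noteq> B" "x \<in> A" "y \<in> B" "x \<otimes> y \<in> U"
  shows "slope U x = y"
  using the1_equality[OF slope_exists[OF assms(1-3)]] assms(4,5) by (auto simp: slope_def)

lemma slope_mult:
  assumes U: "U \<in> cd_atoms" "U \<noteq> B" and x: "x \<in> A" "x' \<in> A"
  shows "slope U (x \<otimes> x') = slope U x \<otimes> slope U x'"
proof (rule slope_eqI[OF U])
  note s = slope[OF U x(1)] slope[OF U x(2)]
  show "x \<otimes> x' \<in> A" "slope U x \<otimes> slope U x' \<in> B"
    using x s atom_subgroup[OF A] atom_subgroup[OF B] by (auto intro: subgroup.m_closed)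
  have "x \<otimes> x' \<otimes> (slope U x \<otimes> slope U x') = (x \<otimes> slope U x) \<otimes> (x' \<otimes> slope U x')"
    using x s by (simp add: V.m_ac)
  also have "\<dots> \<in> U"
    using s atom_subgroup[OF U(1)] by (auto intro: subgroup.m_closed)
  finally show "x \<otimes> x' \<otimes> (slope U x \<otimes> slope U x') \<in> U" .
qed

lemma atom_eq_slope_graph:
  assumes U: "U \<in> cd_atoms" "U \<noteq> B"
  shows "U = (\<lambda>x. x \<otimes> slope U x) ` A"
proof (intro equalityI subsetI)
  fix u assume u: "u \<in> U"
  then have "u \<in> A <#> B"
    using atoms_span[OF A B distinct(1)] atom_subset[OF U(1)] by blast
  then obtain x y where "x \<in> A" "y \<in> B" "u = x \<otimes> y"
    by (auto simp: set_mult_def)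
  moreover from this have "slope U x = y"
    using u U by (intro slope_eqI) auto
  ultimately show "u \<in> (\<lambda>x. x \<otimes> slope U x) ` A"
    by blast
qed (use slope[OF U] in blast)

abbreviation \<phi> where "\<phi> \<equiv> slope C"

lemma \<phi>_closed [simp]: "x \<in> A \<Longrightarrow> \<phi> x \<in> B"
  using slope(1)[OF C] distinct by blast

lemma \<phi>_mult: "x \<in> A \<Longrightarrow> x' \<in> A \<Longrightarrow> \<phi> (x \<otimes> x') = \<phi> x \<otimes> \<phi> x'"
  using slope_mult[OF C] distinct by blast

text \<open>Equal values at \<open>x\<close> and \<open>x'\<close> put
  \<open>x \<otimes> inv x'\<close> into both \<open>A\<close> and \<open>C\<close>; surjectivity
  follows by counting.\<close>

lemma bij_betw_\<phi>: "bij_betw \<phi> A B"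
proof -
  have "inj_on \<phi> A"
  proof (rule inj_onI)
    fix x x' assume x: "x \<in> A" "x' \<in> A" and eq: "\<phi> x = \<phi> x'"
    have "(x \<otimes> \<phi> x) \<otimes> inv (x' \<otimes> \<phi> x') \<in> C"
      using x slope(2)[OF C] distinct atom_subgroup[OF C]
      by (metis subgroup.m_closed subgroup.m_inv_closed)
    also have "(x \<otimes> \<phi> x) \<otimes> inv (x' \<otimes> \<phi> x') = x \<otimes> (\<phi> x' \<otimes> inv (\<phi> x')) \<otimes> inv x'"
      unfolding eq using x by (simp add: V.inv_mult_group V.m_assoc del: V.r_inv V.Units_r_inv)
    also have "\<dots> = x \<otimes> inv x'"
      using x by simp
    finally have "x \<otimes> inv x' \<in> C" .
    moreover have "x \<otimes> inv x' \<in> A"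
      using x atom_subgroup[OF A] by (auto intro: subgroup.m_closed subgroup.m_inv_closed)
    ultimately have "x \<otimes> inv x' = \<one>"
      using atoms_disjoint[OF A C distinct(3)] by blast
    then show "x = x'"
      using x by (metis V.inv_equality V.inv_inv V.inv_closed A_closed)
  qed
  moreover have "\<phi> ` A = B"
  proof (rule card_subset_eq[OF atom_finite[OF B]])
    show "\<phi> ` A \<subseteq> B"
      using \<phi>_closed by blast
    show "card (\<phi> ` A) = card B"
      using card_image[OF calculation] atoms_card[OF A B] by simp
  qed
  ultimately show ?thesis
    by (simp add: bij_betw_def)
qed

lemma \<phi>_one [simp]: "\<phi> \<one> = \<one>"
  using subgroup.one_closed atom_subgroup A B C distinct by (intro slope_eqI) auto

lemma \<phi>_eq_one: "x \<in> A \<Longrightarrow> \<phi> x = \<one> \<Longrightarrow> x = \<one>"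
  using bij_betw_\<phi> \<phi>_one subgroup.one_closed[OF atom_subgroup[OF A]]
  by (metis bij_betw_def inj_onD)

lemma \<kappa>_AA: "x \<in> A \<Longrightarrow> x' \<in> A \<Longrightarrow> \<kappa> x x' = \<one>\<^bsub>W\<^esub>"
  and \<kappa>_BB: "y \<in> B \<Longrightarrow> y' \<in> B \<Longrightarrow> \<kappa> y y' = \<one>\<^bsub>W\<^esub>"
  and \<kappa>_CC: "z \<in> C \<Longrightarrow> z' \<in> C \<Longrightarrow> \<kappa> z z' = \<one>\<^bsub>W\<^esub>"
  using isotropic by (auto simp: perp_def)

text \<open>As \<open>A\<close> and \<open>B\<close> are isotropic, only the mixed terms
  \<open>\<kappa> u z\<close> and \<open>\<kappa> y x\<close> survive, and the latter is the inverse
  of \<open>\<kappa> x y\<close>.\<close>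

lemma \<kappa>_graph:
  assumes "u \<in> A" "x \<in> A" "y \<in> B" "z \<in> B"
  shows "\<kappa> (u \<otimes> y) (x \<otimes> z) = \<one>\<^bsub>W\<^esub> \<longleftrightarrow> \<kappa> u z = \<kappa> x y"
proof -
  have "\<kappa> (u \<otimes> y) (x \<otimes> z) = \<kappa> u z \<otimes>\<^bsub>W\<^esub> \<kappa> y x"
    using assms by (simp add: mult_left mult_right \<kappa>_AA \<kappa>_BB W.m_comm)
  also have "\<dots> = \<kappa> u z \<otimes>\<^bsub>W\<^esub> inv\<^bsub>W\<^esub> (\<kappa> x y)"
    using assms skew[of x y] by simp
  finally have eq: "\<kappa> (u \<otimes> y) (x \<otimes> z) = \<kappa> u z \<otimes>\<^bsub>W\<^esub> inv\<^bsub>W\<^esub> (\<kappa> x y)" .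
  have "\<kappa> u z \<in> carrier W" "\<kappa> x y \<in> carrier W"
    using assms by auto
  then show ?thesis
    unfolding eq using W.inv_solve_right[of "\<one>\<^bsub>W\<^esub>" "\<kappa> u z" "\<kappa> x y"] by (metis W.l_one W.one_closed)
qed

text \<open>The isotropy of \<open>C\<close>, the graph of \<open>\<phi>\<close>, is the symmetry of \<open>\<lambda>u x. \<kappa> u (\<phi> x)\<close>.\<close>

lemma \<kappa>_\<phi>_sym: "u \<in> A \<Longrightarrow> x \<in> A \<Longrightarrow> \<kappa> u (\<phi> x) = \<kappa> x (\<phi> u)"
  using \<kappa>_graph[of u x "\<phi> u" "\<phi> x"] \<kappa>_CC slope(2)[OF C] distinct by auto

text \<open>Symmetry is the isotropy of \<open>C\<close>. For nondegeneracy, an element of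
  \<open>A\<close> pairing trivially with everything is orthogonal to \<open>B\<close>, hence lies
  in \<open>perp B = B\<close>, which meets \<open>A\<close> trivially.\<close>

sublocale P: symmetric_pairing "V\<lparr>carrier := A\<rparr>" W "\<lambda>u x. \<kappa> u (\<phi> x)"
proof -
  have sub: "subgroup A V"
    using atom_subgroup[OF A] .
  have "comm_group (V\<lparr>carrier := A\<rparr>)"
  proof (rule group.group_comm_groupI)
    show "group (V\<lparr>carrier := A\<rparr>)"
      using sub V.is_group by (rule subgroup.subgroup_is_group)
  qed (simp add: V.m_comm)
  moreover have "u = \<one>" if u: "u \<in> A" "\<And>x. x \<in> A \<Longrightarrow> \<kappa> u (\<phi> x) = \<one>\<^bsub>W\<^esub>" for u
  proof -
    have "u \<in> perp B"
      using u bij_betw_imp_surj_on[OF bij_betw_\<phi>] unfolding perp_def by force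
    then have "u \<in> A \<inter> B"
      using isotropic_atom_perp[OF B isotropic(2)] u(1) by blast
    then show ?thesis
      using atoms_disjoint[OF A B distinct(1)] by auto
  qed
  ultimately show "symmetric_pairing (V\<lparr>carrier := A\<rparr>) W (\<lambda>u x. \<kappa> u (\<phi> x))"
    by (simp add: symmetric_pairing_def symmetric_pairing_axioms_def \<phi>_mult mult_right \<kappa>_\<phi>_sym
        W.comm_group_axioms)
qed

text \<open>Composing with \<phi> replaces maps from \<open>A\<close> to \<open>B\<close> by
  endomorphisms of \<open>A\<close>, which form a ring. The zero map gives \<open>A\<close> and the
  identity gives \<open>C\<close>.\<close>

definition graph :: "('a \<Rightarrow> 'a) \<Rightarrow> 'a set" where
  "graph f = (\<lambda>x. x \<otimes> \<phi> (f x)) ` A"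


lemma endo_closed [simp]: "f \<in> carrier P.E \<Longrightarrow> x \<in> A \<Longrightarrow> f x \<in> A"
  using P.endo_closed[of f x] by simp

lemma endo_mult:
  assumes "f \<in> carrier P.E" and "x \<in> A" and "x' \<in> A"
  shows "f (x \<otimes> x') = f x \<otimes> f x'"
proof -
  have "f \<in> hom (V\<lparr>carrier := A\<rparr>) (V\<lparr>carrier := A\<rparr>)"
    using assms(1) carrier_endo_ring by blast
  then show ?thesis
    using hom_mult[of f "V\<lparr>carrier := A\<rparr>" "V\<lparr>carrier := A\<rparr>" x x'] assms(2,3) by simp
qed

lemma adj_iff: "P.adj f h \<longleftrightarrow> (\<forall>u\<in>A. \<forall>x\<in>A. \<kappa> u (\<phi> (f x)) = \<kappa> (h u) (\<phi> x))"
  by (simp add: P.adj_def)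

lemma subgroup_graph:
  assumes f: "f \<in> carrier P.E"
  shows "subgroup (graph f) V"
proof (rule V.subgroupI)
  show "graph f \<subseteq> carrier V"
    using f by (auto simp: graph_def)
  show "graph f \<noteq> {}"
    using subgroup.one_closed[OF atom_subgroup[OF A]] by (auto simp: graph_def)
  have mult: "(x \<otimes> \<phi> (f x)) \<otimes> (x' \<otimes> \<phi> (f x')) = (x \<otimes> x') \<otimes> \<phi> (f (x \<otimes> x'))"
    if "x \<in> A" "x' \<in> A" for x x'
    using that f by (simp add: endo_mult \<phi>_mult V.m_ac)
  show "a \<otimes> b \<in> graph f" if ab: "a \<in> graph f" "b \<in> graph f" for a b
  proof -
    obtain x x' where x: "x \<in> A" "x' \<in> A" "a = x \<otimes> \<phi> (f x)" "b = x' \<otimes> \<phi> (f x')"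
      using ab by (auto simp: graph_def)
    then have "a \<otimes> b = (x \<otimes> x') \<otimes> \<phi> (f (x \<otimes> x'))"
      using mult by simp
    moreover have "x \<otimes> x' \<in> A"
      using x atom_subgroup[OF A] by (auto intro: subgroup.m_closed)
    ultimately show ?thesis
      unfolding graph_def by blast
  qed
  show "inv a \<in> graph f" if a: "a \<in> graph f" for a
  proof -
    obtain x where x: "x \<in> A" "a = x \<otimes> \<phi> (f x)"
      using a by (auto simp: graph_def)
    have ix: "inv x \<in> A"
      using x atom_subgroup[OF A] by (auto intro: subgroup.m_inv_closed)
    have "f \<one> \<otimes> f \<one> = f \<one>" "\<one> \<in> A"
      using endo_mult[OF f, of \<one> \<one>] subgroup.one_closed[OF atom_subgroup[OF A]] by auto
    then have "f \<one> = \<one>"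
      using f by (metis V.l_cancel_one' endo_closed A_closed)
    then have "(inv x \<otimes> \<phi> (f (inv x))) \<otimes> a = \<one>"
      using mult[OF ix x(1)] x by simp
    then have "inv a = inv x \<otimes> \<phi> (f (inv x))"
      using x ix f by (intro V.inv_equality) auto
    then show ?thesis
      using ix unfolding graph_def by blast
  qed
qed

lemma card_graph:
  assumes "f \<in> carrier P.E"
  shows "card (graph f) = card A"
proof -
  have "inj_on (\<lambda>x. x \<otimes> \<phi> (f x)) A"
  proof (rule inj_onI)
    fix x x' assume "x \<in> A" "x' \<in> A" "x \<otimes> \<phi> (f x) = x' \<otimes> \<phi> (f x')"
    then show "x = x'"
      using AB_unique(1)[of x x' "\<phi> (f x)" "\<phi> (f x')"] assms by simp
  qed
  then show ?thesis
    unfolding graph_def by (rule card_image)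
qed

text \<open>By \<open>\<kappa>_graph\<close>, orthogonality of the two graphs says
  \<open>\<kappa> u (\<phi> (f x)) = \<kappa> x (\<phi> (h u))\<close>; symmetry of the pairing
  turns the right side into \<open>\<kappa> (h u) (\<phi> x)\<close>.\<close>

lemma graph_subset_perp_iff:
  assumes f: "f \<in> carrier P.E" and h: "h \<in> carrier P.E"
  shows "graph h \<subseteq> perp (graph f) \<longleftrightarrow> P.adj f h"
proof -
  have "graph h \<subseteq> perp (graph f) \<longleftrightarrow>
      (\<forall>u\<in>A. \<forall>x\<in>A. \<kappa> (u \<otimes> \<phi> (h u)) (x \<otimes> \<phi> (f x)) = \<one>\<^bsub>W\<^esub>)"
    using h by (auto simp: graph_def perp_def)
  also have "\<dots> \<longleftrightarrow> (\<forall>u\<in>A. \<forall>x\<in>A. \<kappa> u (\<phi> (f x)) = \<kappa> x (\<phi> (h u)))"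
    using f h by (simp add: \<kappa>_graph)
  also have "\<dots> \<longleftrightarrow> P.adj f h"
    using h by (simp add: adj_iff \<kappa>_\<phi>_sym[of _ "h _"])
  finally show ?thesis .
qed

text \<open>The graph of an adjoint is orthogonal to \<open>graph f\<close> and has order
  \<open>|A|\<close>, which suffices for \<open>atomI\<close>.\<close>

lemma graph_atom:
  assumes "f \<in> P.adjointable"
  shows "graph f \<in> cd_atoms"
proof -
  obtain h where fh: "f \<in> carrier P.E" "h \<in> carrier P.E" "P.adj f h"
    using assms unfolding P.adjointable_def by blast
  show ?thesis
    using atomI[OF A subgroup_graph[OF fh(1)] card_graph[OF fh(1)] _ card_graph[OF fh(2)]]
      graph_subset_perp_iff[OF fh(1,2)] fh(3) by blast
qed

lemma graph_neq_B:
  assumes f: "f \<in> carrier P.E"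
  shows "graph f \<noteq> B"
proof
  assume eq: "graph f = B"
  have "A \<subseteq> {\<one>}"
  proof
    fix x assume x: "x \<in> A"
    then obtain y where "y \<in> B" "x \<otimes> \<phi> (f x) = \<one> \<otimes> y"
      using eq unfolding graph_def by (metis B_closed V.l_one image_eqI)
    then show "x \<in> {\<one>}"
      using AB_unique(1)[of x \<one> "\<phi> (f x)" y] x f subgroup.one_closed[OF atom_subgroup[OF A]] by simp
  qed
  then have "card A \<le> 1"
    using card_mono[of "{\<one>}" A] by simp
  then show False
    using card_atom_gt_1[OF A] by simp
qed

lemma inj_on_graph: "inj_on graph (carrier P.E)"
proof (rule inj_onI)
  fix f h assume f: "f \<in> carrier P.E" and h: "h \<in> carrier P.E" and eq: "graph f = graph h"
  show "f = h"
  proof (rule endo_ring_ext[OF f h])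
    fix x assume "x \<in> carrier (V\<lparr>carrier := A\<rparr>)"
    then have x: "x \<in> A"
      by simp
    then obtain x' where x': "x' \<in> A" "x \<otimes> \<phi> (f x) = x' \<otimes> \<phi> (h x')"
      using eq unfolding graph_def by blast
    then have "x = x'" "\<phi> (f x) = \<phi> (h x')"
      using AB_unique[of x x' "\<phi> (f x)" "\<phi> (h x')"] x f h by auto
    then show "f x = h x"
      using bij_betw_\<phi> x f h unfolding bij_betw_def by (metis endo_closed inj_onD)
  qed
qed

lemma atom_eq_graph:
  assumes U: "U \<in> cd_atoms" "U \<noteq> B"
  obtains f where "f \<in> carrier P.E" and "U = graph f"
proof -
  \<comment> \<open>The slope of \<open>U\<close> pulled back along the bijection \<phi>.\<close>
  let ?f = "\<lambda>x\<in>A. inv_into A \<phi> (slope U x)"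
  have \<phi>_f: "\<phi> (?f x) = slope U x" "?f x \<in> A" if "x \<in> A" for x
  proof -
    have "slope U x \<in> \<phi> ` A"
      using slope(1)[OF U that] bij_betw_\<phi> by (simp add: bij_betw_def)
    with that show "\<phi> (?f x) = slope U x" "?f x \<in> A"
      by (auto simp: f_inv_into_f inv_into_into)
  qed
  have "?f (x \<otimes> x') = ?f x \<otimes> ?f x'" if x: "x \<in> A" "x' \<in> A" for x x'
  proof -
    have xx: "x \<otimes> x' \<in> A" "?f x \<otimes> ?f x' \<in> A"
      using x \<phi>_f(2) atom_subgroup[OF A] by (auto intro: subgroup.m_closed simp del: restrict_apply)
    then have "\<phi> (?f (x \<otimes> x')) = \<phi> (?f x \<otimes> ?f x')"
      using x \<phi>_f U by (simp add: \<phi>_mult slope_mult del: restrict_apply)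
    then show ?thesis
      using bij_betw_\<phi> \<phi>_f(2)[OF xx(1)] xx(2) unfolding bij_betw_def by (meson inj_onD)
  qed
  then have "?f \<in> hom (V\<lparr>carrier := A\<rparr>) (V\<lparr>carrier := A\<rparr>)"
    using \<phi>_f(2) by (intro homI) (simp_all del: restrict_apply)
  then have "?f \<in> carrier P.E"
    by (simp add: carrier_endo_ring)
  moreover have "U = graph ?f"
    using atom_eq_slope_graph[OF U] \<phi>_f(1) by (simp add: graph_def del: restrict_apply cong: image_cong)
  ultimately show thesis
    using that by blast
qed

text \<open>For an atom \<open>U\<close> other than \<open>B\<close>, \<open>perp U\<close> is again
  an atom, and it differs from \<open>B\<close> because \<open>perp B = B\<close>. So both are
  graphs, and the endomorphism of \<open>perp U\<close> is adjoint to that of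
  \<open>U\<close>.\<close>

lemma atoms_eq: "cd_atoms = insert B (graph ` P.adjointable)"
proof (intro equalityI subsetI)
  fix U assume U: "U \<in> cd_atoms"
  show "U \<in> insert B (graph ` P.adjointable)"
  proof (cases "U = B")
    case False
    have "perp U \<noteq> B"
    proof
      assume "perp U = B"
      then have "U \<subseteq> perp B"
        using subset_perp_perp atom_subset[OF U] by blast
      also have "perp B = B"
        using isotropic_atom_perp[OF B isotropic(2)] .
      finally have "U = B"
        using card_subset_eq[OF atom_finite[OF B]] atoms_card[OF U B] by blast
      with False show False ..
    qed
    obtain f where f: "f \<in> carrier P.E" "U = graph f"
      using atom_eq_graph[OF U False] .
    obtain h where h: "h \<in> carrier P.E" "perp U = graph h"
      using atom_eq_graph[OF perp_atom[OF U] \<open>perp U \<noteq> B\<close>] .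
    have "P.adj f h"
      using graph_subset_perp_iff[OF f(1) h(1)] f(2) h(2) by blast
    then show ?thesis
      using f h unfolding P.adjointable_def by blast
  qed simp
next
  fix U assume "U \<in> insert B (graph ` P.adjointable)"
  then show "U \<in> cd_atoms"
    using B graph_atom by blast
qed

lemma isotropic_atoms_eq:
  "{U \<in> cd_atoms. U \<subseteq> perp U} = insert B (graph ` {f \<in> P.adjointable. P.adj f f})"
  using isotropic(2) graph_subset_perp_iff P.adjointable_subset by (auto simp: atoms_eq)

text \<open>For nonzero \<open>f\<close> the atoms \<open>graph f\<close> and \<open>A\<close>
  differ, so they meet trivially; \<open>f u = f u'\<close> puts \<open>u \<otimes> inv u'\<close>
  into both.\<close>

lemma inj_on_adjointable:
  assumes f: "f \<in> P.adjointable" "f \<noteq> \<zero>\<^bsub>P.E\<^esub>"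
  shows "inj_on f A"
proof -
  have fE: "f \<in> carrier P.E"
    using P.adjointable_subset[OF f(1)] .
  have one: "\<one> \<in> A" "\<one> \<in> B"
    using subgroup.one_closed atom_subgroup A B by blast+
  have "\<exists>x\<in>A. f x \<noteq> \<one>"
    using endo_ring_ext[OF fE P.E.zero_closed] f(2) by auto
  then obtain x where x: "x \<in> A" "f x \<noteq> \<one>"
    by blast
  have "graph f \<noteq> A"
  proof
    assume eq: "graph f = A"
    have "x \<otimes> \<phi> (f x) \<in> graph f"
      using x unfolding graph_def by blast
    then have xA: "x \<otimes> \<phi> (f x) \<in> A"
      using eq by simp
    have "x \<otimes> \<phi> (f x) \<otimes> \<one> = x \<otimes> \<phi> (f x)" "\<phi> (f x) \<in> B"
      using x fE by simp_all
    then have "\<phi> (f x) = \<one>"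
      using AB_unique(2)[OF xA x(1) one(2), of "\<phi> (f x)"] by metis
    then show False
      using \<phi>_eq_one x fE by simp
  qed
  then have disj: "graph f \<inter> A = {\<one>}"
    using atoms_disjoint graph_atom[OF f(1)] A by blast
  show ?thesis
  proof (rule inj_onI)
    fix u u' assume u: "u \<in> A" "u' \<in> A" and eq: "f u = f u'"
    have sub: "subgroup (graph f) V"
      using subgroup_graph[OF fE] .
    have "(u \<otimes> \<phi> (f u)) \<otimes> inv (u' \<otimes> \<phi> (f u')) \<in> graph f"
      using u subgroup.m_closed[OF sub] subgroup.m_inv_closed[OF sub] unfolding graph_def by blast
    also have "(u \<otimes> \<phi> (f u)) \<otimes> inv (u' \<otimes> \<phi> (f u')) = u \<otimes> (\<phi> (f u') \<otimes> inv (\<phi> (f u'))) \<otimes> inv u'"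
      unfolding eq using u fE by (simp add: V.inv_mult_group V.m_assoc del: V.r_inv V.Units_r_inv)
    also have "\<dots> = u \<otimes> inv u'"
      using u fE by simp
    finally have "u \<otimes> inv u' \<in> graph f" .
    moreover have "u \<otimes> inv u' \<in> A"
      using u atom_subgroup[OF A] by (auto intro: subgroup.m_closed subgroup.m_inv_closed)
    ultimately have "u \<otimes> inv u' = \<one>"
      using disj by blast
    then show "u = u'"
      using u by (metis V.inv_equality V.inv_inv V.inv_closed A_closed)
  qed
qed

text \<open>The summand 1 in both counts is the atom \<open>B\<close>, which is isotropic and not a
  graph. The exponent of \<open>|V|\<close> is doubled because \<open>|V| = |A|^2\<close>.\<close>

theorem card_cd_atoms:
  assumes p: "Factorial_Ring.prime p" and exp: "\<And>x. x \<in> carrier V \<Longrightarrow> x [^] (p::nat) = \<one>"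
  obtains a b k where "a > 0" "b > 0" "card cd_atoms = p ^ a + 1"
    "card {U \<in> cd_atoms. U \<subseteq> perp U} = p ^ b + 1" "a = b \<or> a = 2 * b"
    "card (carrier V) = p ^ (2 * (a * k))"
proof (rule P.card_adjointable[OF _ _ p])
  show "finite (carrier (V\<lparr>carrier := A\<rparr>))"
    using atom_finite[OF A] by simp
  show "carrier (V\<lparr>carrier := A\<rparr>) \<noteq> {\<one>\<^bsub>V\<lparr>carrier := A\<rparr>\<^esub>}"
    using A by (simp add: cd_atoms_def)
  show "x [^]\<^bsub>V\<lparr>carrier := A\<rparr>\<^esub> p = \<one>\<^bsub>V\<lparr>carrier := A\<rparr>\<^esub>" if "x \<in> carrier (V\<lparr>carrier := A\<rparr>)" for x
    using that exp by (simp add: V.nat_pow_consistent[symmetric])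
  show "inj_on f (carrier (V\<lparr>carrier := A\<rparr>))" if "f \<in> P.adjointable" "f \<noteq> \<zero>\<^bsub>P.E\<^esub>" for f
    using inj_on_adjointable[OF that] by simp
next
  fix a b k assume ab: "a > 0" "b > 0" "a = b \<or> a = 2 * b"
    and card: "card P.adjointable = p ^ a" "card {f \<in> P.adjointable. P.adj f f} = p ^ b"
    and cardA: "card (carrier (V\<lparr>carrier := A\<rparr>)) = p ^ (a * k)"
  \<comment> \<open>Infinite sets have cardinality 0, so the condition
    \<open>card S \<noteq> 0\<close> supplies finiteness.\<close>
  have card_insert_graph: "card (insert B (graph ` S)) = card S + 1" if "S \<subseteq> P.adjointable" "card S \<noteq> 0" for S
  proof -
    have SE: "S \<subseteq> carrier P.E"
      using that P.adjointable_subset by blast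
    have "finite S"
      using that(2) by (rule contrapos_np) simp
    moreover have "B \<notin> graph ` S"
      using SE graph_neq_B by blast
    moreover have "card (graph ` S) = card S"
      using inj_on_subset[OF inj_on_graph SE] by (rule card_image)
    ultimately show ?thesis
      by simp
  qed
  have "p > 0"
    using prime_gt_0_nat[OF p] .
  then have "card cd_atoms = p ^ a + 1" "card {U \<in> cd_atoms. U \<subseteq> perp U} = p ^ b + 1"
    unfolding isotropic_atoms_eq using card_insert_graph[of P.adjointable]
      card_insert_graph[of "{f \<in> P.adjointable. P.adj f f}"] card by (auto simp: atoms_eq)
  moreover have "card (carrier V) = p ^ (2 * (a * k))"
    using card_atom_square[OF A] cardA by (simp add: power_add mult_2)
  ultimately show thesis
    using ab by (intro that[of a b k])
qed

end

section \<open>The commutator form\<close>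

context group
begin

lemma subgroup_centralizer:
  assumes "H \<subseteq> carrier G"
  shows "subgroup (centralizer G H) G"
proof (rule subgroupI)
  show "a \<otimes> b \<in> centralizer G H" if ab: "a \<in> centralizer G H" "b \<in> centralizer G H" for a b
  proof -
    have "a \<otimes> b \<otimes> h = h \<otimes> (a \<otimes> b)" if "h \<in> H" for h
    proof -
      have "a \<in> carrier G" "b \<in> carrier G" "h \<in> carrier G" "a \<otimes> h = h \<otimes> a" "b \<otimes> h = h \<otimes> b"
        using ab that assms by (auto simp: centralizer_def)
      then show ?thesis
        by (metis m_assoc)
    qed
    then show ?thesis
      using ab by (simp add: centralizer_def)
  qed
  show "inv a \<in> centralizer G H" if a: "a \<in> centralizer G H" for a
  proof -
    have "inv a \<otimes> h = h \<otimes> inv a" if "h \<in> H" for h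
    proof -
      have ah: "a \<in> carrier G" "h \<in> carrier G" "a \<otimes> h = h \<otimes> a"
        using a that assms by (auto simp: centralizer_def)
      then have "h = inv a \<otimes> (h \<otimes> a)"
        using inv_solve_left by (metis m_closed)
      with ah show ?thesis
        using inv_solve_right[of "inv a \<otimes> h" h a] by (simp add: m_assoc)
    qed
    then show ?thesis
      using a by (simp add: centralizer_def)
  qed
  show "centralizer G H \<noteq> {}"
    using assms by (auto simp: centralizer_def intro!: exI[of _ \<one>])
qed (auto simp: centralizer_def)

lemma subset_centralizer_centralizer:
  "H \<subseteq> carrier G \<Longrightarrow> H \<subseteq> centralizer G (centralizer G H)"
  by (auto simp: centralizer_def subset_iff)

lemma center_subset_centralizer: "H \<subseteq> carrier G \<Longrightarrow> center G \<subseteq> centralizer G H"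
  by (auto simp: center_def centralizer_def subset_iff)

lemma mem_center_iff: "z \<in> center G \<longleftrightarrow> z \<in> carrier G \<and> (\<forall>x\<in>carrier G. z \<otimes> x = x \<otimes> z)"
  by (simp add: center_def centralizer_def)

lemma centralizer_center: "centralizer G (center G) = carrier G"
  by (auto simp: center_def centralizer_def)

lemma comm_group_subgroup_iff:
  assumes "subgroup H G"
  shows "comm_group (G\<lparr>carrier := H\<rparr>) \<longleftrightarrow> H \<subseteq> centralizer G H"
proof
  assume "comm_group (G\<lparr>carrier := H\<rparr>)"
  then interpret H: comm_group "G\<lparr>carrier := H\<rparr>" .
  show "H \<subseteq> centralizer G H"
    using H.m_comm subgroup.subset[OF assms] by (auto simp: centralizer_def)
next
  assume comm: "H \<subseteq> centralizer G H"
  show "comm_group (G\<lparr>carrier := H\<rparr>)"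
  proof (rule group.group_comm_groupI)
    show "group (G\<lparr>carrier := H\<rparr>)"
      using assms is_group by (rule subgroup.subgroup_is_group)
  qed (use comm in \<open>auto simp: centralizer_def\<close>)
qed

lemma normal_center: "center G \<lhd> G"
proof (rule normalI)
  show "subgroup (center G) G"
    using subgroup_centralizer by (simp add: center_def)
  show "\<forall>x\<in>carrier G. center G #> x = x <# center G"
    by (auto simp: r_coset_def l_coset_def center_def centralizer_def)
qed

definition comm :: "'a \<Rightarrow> 'a \<Rightarrow> 'a" where
  "comm x y = x \<otimes> y \<otimes> inv x \<otimes> inv y"

lemma comm_closed [simp]: "x \<in> carrier G \<Longrightarrow> y \<in> carrier G \<Longrightarrow> comm x y \<in> carrier G"
  by (simp add: comm_def)

lemma comm_eq_one_iff:
  assumes "x \<in> carrier G" and "y \<in> carrier G"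
  shows "comm x y = \<one> \<longleftrightarrow> x \<otimes> y = y \<otimes> x"
proof -
  have "comm x y = (x \<otimes> y) \<otimes> inv (y \<otimes> x)"
    using assms by (simp add: comm_def inv_mult_group m_assoc)
  then show ?thesis
    using assms inv_solve_right[of \<one> "x \<otimes> y" "y \<otimes> x"] by (metis l_one m_closed one_closed)
qed

lemma inv_comm:
  assumes "x \<in> carrier G" and "y \<in> carrier G"
  shows "inv (comm x y) = comm y x"
  using assms by (simp add: comm_def inv_mult_group m_assoc)

end

section \<open>The commutator form of a finite group of nilpotency class at most two\<close>

locale class2_group = group +
  assumes finite_carrier: "finite (carrier G)"
    and comm_group_Mod_center: "comm_group (G Mod center G)"
begin

abbreviation Z where "Z \<equiv> center G"
abbreviation V where "V \<equiv> G Mod Z"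
abbreviation \<pi> where "\<pi> x \<equiv> Z #> x"

sublocale Z: normal Z G
  by (rule normal_center)

sublocale V: comm_group V
  by (rule comm_group_Mod_center)

sublocale \<pi>: group_hom G V "\<lambda>x. \<pi> x"
  by (intro group_hom.intro group_hom_axioms.intro is_group V.is_group Z.r_coset_hom_Mod)

lemma Z_comm: "z \<in> Z \<Longrightarrow> x \<in> carrier G \<Longrightarrow> z \<otimes> x = x \<otimes> z"
  using mem_center_iff by blast

lemma Z_closed [simp]: "z \<in> Z \<Longrightarrow> z \<in> carrier G"
  using Z.subset by blast

lemma carrier_V: "carrier V = \<pi> ` carrier G"
  by (auto simp: FactGroup_def RCOSETS_def)

lemma one_V: "\<one>\<^bsub>V\<^esub> = Z"
  by (simp add: FactGroup_def)

lemma \<pi>_eq_one_iff: "x \<in> carrier G \<Longrightarrow> \<pi> x = \<one>\<^bsub>V\<^esub> \<longleftrightarrow> x \<in> Z"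
  using coset_join1 coset_join2 Z.subgroup_axioms unfolding one_V by blast

lemma \<pi>_eq_iff:
  assumes "x \<in> carrier G" and "y \<in> carrier G"
  shows "\<pi> x = \<pi> y \<longleftrightarrow> x \<otimes> inv y \<in> Z"
proof -
  have "\<pi> x = \<pi> y \<longleftrightarrow> \<pi> x \<otimes>\<^bsub>V\<^esub> inv\<^bsub>V\<^esub> (\<pi> y) = \<one>\<^bsub>V\<^esub>"
    using assms V.inv_solve_right[of "\<one>\<^bsub>V\<^esub>" "\<pi> x" "\<pi> y"]
    by (metis V.l_one V.one_closed \<pi>.hom_closed)
  also have "\<dots> \<longleftrightarrow> \<pi> (x \<otimes> inv y) = \<one>\<^bsub>V\<^esub>"
    using assms by simp
  finally show ?thesis
    using assms \<pi>_eq_one_iff[of "x \<otimes> inv y"] by simp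
qed

lemma comm_in_Z [simp]:
  assumes "x \<in> carrier G" and "y \<in> carrier G"
  shows "comm x y \<in> Z"
proof -
  have "\<pi> (comm x y) = \<pi> x \<otimes>\<^bsub>V\<^esub> \<pi> y \<otimes>\<^bsub>V\<^esub> inv\<^bsub>V\<^esub> (\<pi> x) \<otimes>\<^bsub>V\<^esub> inv\<^bsub>V\<^esub> (\<pi> y)"
    unfolding comm_def using assms by (simp only: \<pi>.hom_mult \<pi>.hom_inv m_closed inv_closed)
  also have "\<dots> = \<one>\<^bsub>V\<^esub>"
    using assms by (metis V.comm_eq_one_iff V.comm_def V.m_comm \<pi>.hom_closed)
  finally show ?thesis
    using \<pi>_eq_one_iff[OF comm_closed[OF assms]] by blast
qed

text \<open>The commutator of \<open>x \<otimes> y\<close> with \<open>z\<close> is the conjugate by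
  \<open>x\<close> of \<open>comm y z\<close>, times \<open>comm x z\<close>. Conjugation does
  nothing, as commutators are central.\<close>

lemma comm_mult_left:
  assumes "x \<in> carrier G" and "y \<in> carrier G" and "z \<in> carrier G"
  shows "comm (x \<otimes> y) z = comm x z \<otimes> comm y z"
proof -
  have "comm (x \<otimes> y) z = x \<otimes> comm y z \<otimes> (z \<otimes> inv x \<otimes> inv z)"
    using assms by (simp add: comm_def inv_mult_group m_assoc) (simp flip: m_assoc)
  also have "\<dots> = comm y z \<otimes> x \<otimes> (z \<otimes> inv x \<otimes> inv z)"
    using assms Z_comm[of "comm y z" x] by simp
  also have "\<dots> = comm y z \<otimes> comm x z"
    using assms by (simp add: comm_def m_assoc)
  also have "\<dots> = comm x z \<otimes> comm y z"
    using assms by (intro Z_comm) auto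
  finally show ?thesis .
qed

lemma comm_mult_right:
  assumes "x \<in> carrier G" and "y \<in> carrier G" and "z \<in> carrier G"
  shows "comm x (y \<otimes> z) = comm x y \<otimes> comm x z"
proof -
  have "comm x (y \<otimes> z) = inv (comm y x \<otimes> comm z x)"
    using assms by (simp add: comm_mult_left flip: inv_comm[of "y \<otimes> z" x])
  also have "\<dots> = comm x z \<otimes> comm x y"
    using assms by (simp add: inv_mult_group inv_comm)
  also have "\<dots> = comm x y \<otimes> comm x z"
    using assms by (intro Z_comm) auto
  finally show ?thesis .
qed

text \<open>Arbitrary coset representatives are chosen; by \<open>\<kappa>_\<pi>\<close> the value
  does not depend on them.\<close>

definition \<kappa> :: "'a set \<Rightarrow> 'a set \<Rightarrow> 'a" where
  "\<kappa> S T = comm (SOME x. x \<in> carrier G \<and> \<pi> x = S) (SOME y. y \<in> carrier G \<and> \<pi> y = T)"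

text \<open>Representatives of one coset differ by a central factor, whose commutator with
  \<open>y\<close> is trivial.\<close>

lemma comm_cong:
  assumes "x \<in> carrier G" "x' \<in> carrier G" "y \<in> carrier G" and "\<pi> x' = \<pi> x"
  shows "comm x' y = comm x y"
proof -
  have z: "x' \<otimes> inv x \<in> Z"
    using \<pi>_eq_iff[OF assms(2,1)] assms(4) by blast
  have "comm x' y = comm (x' \<otimes> inv x \<otimes> x) y"
    using assms(1-3) by (simp add: m_assoc)
  also have "\<dots> = comm (x' \<otimes> inv x) y \<otimes> comm x y"
    using assms(1-3) by (intro comm_mult_left) auto
  also have "comm (x' \<otimes> inv x) y = \<one>"
    using assms(1-3) z by (simp add: comm_eq_one_iff Z_comm)
  finally show ?thesis
    using assms(1-3) by simp
qed

lemma \<kappa>_\<pi>: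
  assumes "x \<in> carrier G" and "y \<in> carrier G"
  shows "\<kappa> (\<pi> x) (\<pi> y) = comm x y"
proof -
  define x' y' where "x' = (SOME a. a \<in> carrier G \<and> \<pi> a = \<pi> x)"
    and "y' = (SOME a. a \<in> carrier G \<and> \<pi> a = \<pi> y)"
  have x': "x' \<in> carrier G \<and> \<pi> x' = \<pi> x"
    unfolding x'_def using assms(1) by (rule someI[of "\<lambda>a. a \<in> carrier G \<and> \<pi> a = \<pi> x", OF conjI]) (rule refl)
  have y': "y' \<in> carrier G \<and> \<pi> y' = \<pi> y"
    unfolding y'_def using assms(2) by (rule someI[of "\<lambda>a. a \<in> carrier G \<and> \<pi> a = \<pi> y", OF conjI]) (rule refl)
  have "comm x' y' = comm x y'"
    using assms x' y' by (intro comm_cong) auto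
  also have "\<dots> = inv (comm y' x)"
    using assms y' by (simp add: inv_comm)
  also have "comm y' x = comm y x"
    using assms y' by (intro comm_cong) auto
  also have "inv (comm y x) = comm x y"
    using assms by (simp add: inv_comm)
  finally show ?thesis
    by (simp add: \<kappa>_def x'_def y'_def)
qed

lemma V_cases:
  assumes "S \<in> carrier V"
  obtains x where "x \<in> carrier G" "S = \<pi> x"
  using assms unfolding carrier_V by blast

lemma comm_group_center: "comm_group (G\<lparr>carrier := Z\<rparr>)"
  using comm_group_subgroup_iff[OF Z.subgroup_axioms] Z.subset unfolding centralizer_center by blast

lemma \<kappa>_alternating_form: "alternating_form V (G\<lparr>carrier := Z\<rparr>) \<kappa>"
proof (intro alternating_form.intro alternating_form_axioms.intro comm_group_center comm_group_Mod_center)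
  show "finite (carrier V)"
    using finite_carrier by (simp add: carrier_V)
  fix S S' assume S: "S \<in> carrier V" and S': "S' \<in> carrier V"
  obtain x y where x: "x \<in> carrier G" "S = \<pi> x" and y: "y \<in> carrier G" "S' = \<pi> y"
    using S S' V_cases by metis
  show "\<kappa> S S' \<in> carrier (G\<lparr>carrier := Z\<rparr>)"
    using x y by (simp add: \<kappa>_\<pi>)
  fix T assume "T \<in> carrier V"
  then obtain z where z: "z \<in> carrier G" "T = \<pi> z"
    by (rule V_cases)
  have "S \<otimes>\<^bsub>V\<^esub> S' = \<pi> (x \<otimes> y)" "S' \<otimes>\<^bsub>V\<^esub> T = \<pi> (y \<otimes> z)"
    using x y z by simp_all
  then show "\<kappa> (S \<otimes>\<^bsub>V\<^esub> S') T = \<kappa> S T \<otimes>\<^bsub>G\<lparr>carrier := Z\<rparr>\<^esub> \<kappa> S' T"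
    "\<kappa> S (S' \<otimes>\<^bsub>V\<^esub> T) = \<kappa> S S' \<otimes>\<^bsub>G\<lparr>carrier := Z\<rparr>\<^esub> \<kappa> S T"
    using x y z \<kappa>_\<pi> comm_mult_left comm_mult_right by (simp_all del: \<pi>.hom_mult)
next
  fix S assume "S \<in> carrier V"
  then obtain x where "x \<in> carrier G" "S = \<pi> x"
    by (rule V_cases)
  then show "\<kappa> S S = \<one>\<^bsub>G\<lparr>carrier := Z\<rparr>\<^esub>"
    by (simp add: \<kappa>_\<pi> comm_eq_one_iff)
qed

sublocale form: alternating_form V "G\<lparr>carrier := Z\<rparr>" \<kappa>
  by (rule \<kappa>_alternating_form)

text \<open>Elements commute exactly when the form is trivial on their cosets, so centralizers
  become orthogonal subgroups.\<close>

lemma perp_image: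
  assumes "H \<subseteq> carrier G"
  shows "form.perp (\<pi> ` H) = \<pi> ` centralizer G H"
proof -
  have *: "\<pi> x \<in> form.perp (\<pi> ` H) \<longleftrightarrow> x \<in> centralizer G H" if "x \<in> carrier G" for x
    using that assms by (auto simp: form.perp_def centralizer_def \<kappa>_\<pi> comm_eq_one_iff subset_iff)
  show ?thesis
  proof (intro equalityI subsetI)
    fix S assume S: "S \<in> form.perp (\<pi> ` H)"
    then have "S \<in> carrier V"
      using form.perp_subset by blast
    then obtain x where "x \<in> carrier G" "S = \<pi> x"
      by (rule V_cases)
    with S * show "S \<in> \<pi> ` centralizer G H"
      by blast
  next
    fix S assume "S \<in> \<pi> ` centralizer G H"
    then obtain x where "x \<in> centralizer G H" "S = \<pi> x"
      by blast
    moreover from this have "x \<in> carrier G"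
      by (simp add: centralizer_def)
    ultimately show "S \<in> form.perp (\<pi> ` H)"
      using * by blast
  qed
qed

lemma carrier_mod_center: "carrier (mod_center G H) = \<pi> ` H"
  by (auto simp: mod_center_def FactGroup_def RCOSETS_def r_coset_def)

lemma card_subgroup:
  assumes "subgroup H G" and "Z \<subseteq> H"
  shows "card H = card Z * card (\<pi> ` H)"
proof -
  interpret H: group "G\<lparr>carrier := H\<rparr>"
    using assms(1) is_group by (rule subgroup.subgroup_is_group)
  have "subgroup Z (G\<lparr>carrier := H\<rparr>)"
    using subgroup_incl[OF Z.subgroup_axioms assms] .
  from H.lagrange[OF this] have "card (carrier (mod_center G H)) * card Z = card H"
    by (simp add: mod_center_def FactGroup_def Coset.order_def)
  then show ?thesis
    by (simp add: carrier_mod_center mult.commute)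
qed

lemma mem_image_\<pi>_iff:
  assumes H: "subgroup H G" "Z \<subseteq> H" and x: "x \<in> carrier G"
  shows "\<pi> x \<in> \<pi> ` H \<longleftrightarrow> x \<in> H"
proof
  assume "\<pi> x \<in> \<pi> ` H"
  then obtain h where h: "h \<in> H" "\<pi> x = \<pi> h"
    by blast
  then have hG: "h \<in> carrier G"
    using subgroup.subset[OF H(1)] by blast
  then have "x \<otimes> inv h \<in> H"
    using h(2) x \<pi>_eq_iff H(2) by blast
  then have "x \<otimes> inv h \<otimes> h \<in> H"
    using h(1) subgroup.m_closed[OF H(1)] by blast
  then show "x \<in> H"
    using x hG by (simp add: m_assoc)
qed blast

lemma subset_image_\<pi>_iff:
  assumes "subgroup H G" "Z \<subseteq> H" and "K \<subseteq> carrier G"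
  shows "\<pi> ` K \<subseteq> \<pi> ` H \<longleftrightarrow> K \<subseteq> H"
  using mem_image_\<pi>_iff[OF assms(1,2)] assms(3) by blast

text \<open>Both \<open>H\<close> and its centralizer contain the center, so each contributes one
  factor \<open>|Z|\<close>.\<close>

lemma cd_measure_eq_perp:
  assumes "subgroup H G" and "Z \<subseteq> H"
  shows "cd_measure G H = (card Z)\<^sup>2 * (card (\<pi> ` H) * card (form.perp (\<pi> ` H)))"
proof -
  have HG: "H \<subseteq> carrier G"
    using subgroup.subset[OF assms(1)] .
  have "card (centralizer G H) = card Z * card (form.perp (\<pi> ` H))"
    unfolding perp_image[OF HG]
    by (rule card_subgroup[OF subgroup_centralizer[OF HG] center_subset_centralizer[OF HG]])
  then show ?thesis
    using card_subgroup[OF assms] by (simp add: cd_measure_def power2_eq_square)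
qed

lemma subgroup_V_cases:
  assumes U: "subgroup U V"
  obtains H where "subgroup H G" "Z \<subseteq> H" "U = \<pi> ` H"
proof
  let ?H = "{x \<in> carrier G. \<pi> x \<in> U}"
  interpret U: subgroup U V by (rule U)
  have one: "\<pi> \<one> \<in> U"
    unfolding \<pi>.hom_one by (rule U.one_closed)
  have mult: "\<pi> (a \<otimes> b) \<in> U" if "a \<in> ?H" "b \<in> ?H" for a b
  proof -
    have "\<pi> (a \<otimes> b) = \<pi> a \<otimes>\<^bsub>V\<^esub> \<pi> b"
      using that by (intro \<pi>.hom_mult) auto
    also have "\<dots> \<in> U"
      using that by (intro U.m_closed) auto
    finally show ?thesis .
  qed
  have inv: "\<pi> (inv a) \<in> U" if "a \<in> ?H" for a
  proof -
    have "\<pi> (inv a) = inv\<^bsub>V\<^esub> (\<pi> a)"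
      using that by (intro \<pi>.hom_inv) auto
    also have "\<dots> \<in> U"
      using that by (intro U.m_inv_closed) auto
    finally show ?thesis .
  qed
  show "subgroup ?H G"
    using one mult inv by (intro subgroupI) blast+
  show "Z \<subseteq> ?H"
    using \<pi>_eq_one_iff U.one_closed Z.subset by force
  show "U = \<pi> ` ?H"
    using U.subset unfolding carrier_V by blast
qed

lemma subgroup_image_\<pi>: "subgroup H G \<Longrightarrow> subgroup (\<pi> ` H) V"
  by (rule \<pi>.subgroup_img_is_subgroup)


lemma cd_measure_le:
  assumes "subgroup H G"
  shows "cd_measure G H \<le> cd_max G"
proof -
  have "{cd_measure G H | H. subgroup H G} = cd_measure G ` {H. subgroup H G}"
    by blast
  moreover have "finite {H. subgroup H G}"
  proof (rule finite_subset)
    show "{H. subgroup H G} \<subseteq> Pow (carrier G)"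
      using subgroup.subset by blast
    show "finite (Pow (carrier G))"
      using finite_carrier by (rule finite_Pow_iff[THEN iffD2])
  qed
  ultimately have fin: "finite {cd_measure G H | H. subgroup H G}"
    by simp
  show ?thesis
    unfolding cd_max_def using assms by (intro Max_ge[OF fin]) auto
qed

text \<open>A subgroup \<open>H\<close> of maximal measure is its own double centralizer: otherwise \<open>C\<^sub>G(H)\<close>
  would have larger measure.\<close>

lemma center_subset_cd:
  assumes H: "subgroup H G" and max: "cd_measure G H = cd_max G"
  shows "Z \<subseteq> H"
proof -
  let ?C = "centralizer G"
  have HG: "H \<subseteq> carrier G"
    using subgroup.subset[OF H] .
  have CG: "?C H \<subseteq> carrier G" "?C (?C H) \<subseteq> carrier G"
    by (auto simp: centralizer_def)
  have C: "subgroup (?C H) G"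
    using subgroup_centralizer[OF HG] .
  have "card (?C H) * card (?C (?C H)) \<le> card (?C H) * card H"
    using cd_measure_le[OF C] max by (simp add: cd_measure_def mult.commute)
  moreover have "card (?C H) > 0"
    using subgroup.one_closed[OF C] finite_subset[OF CG(1) finite_carrier] by (auto simp: card_gt_0_iff)
  ultimately have le: "card (?C (?C H)) \<le> card H"
    by simp
  have "H = ?C (?C H)"
    using finite_subset[OF CG(2) finite_carrier] subset_centralizer_centralizer[OF HG] le
    by (rule card_seteq)
  then show ?thesis
    using center_subset_centralizer[OF CG(1)] by simp
qed

end

section \<open>The Chermak-Delgado lattice and its translation to the form\<close>

locale cd_quasi_antichain_group = class2_group +
  fixes w
  assumes quasi_antichain: "quasi_antichain (cd_lattice G) w"
    and direct: "H \<in> atoms (cd_lattice G) \<Longrightarrow> K \<in> atoms (cd_lattice G) \<Longrightarrow> H \<noteq> K \<Longrightarrow>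
      internal_direct_product (G Mod center G) (carrier (mod_center G H)) (carrier (mod_center G K))"
    and isomorphic: "H \<in> atoms (cd_lattice G) \<Longrightarrow> K \<in> atoms (cd_lattice G) \<Longrightarrow> H \<noteq> K \<Longrightarrow>
      mod_center G H \<cong> mod_center G K"
begin

abbreviation L where "L \<equiv> cd_lattice G"

lemma L_carrier_iff: "H \<in> carrier L \<longleftrightarrow> subgroup H G \<and> cd_measure G H = cd_max G"
  by (simp add: cd_lattice_def)

lemma L_le_iff: "H \<sqsubseteq>\<^bsub>L\<^esub> K \<longleftrightarrow> H \<subseteq> K"
  by (simp add: cd_lattice_def)

lemma L_lless_iff: "H \<sqsubset>\<^bsub>L\<^esub> K \<longleftrightarrow> H \<subset> K"
  by (auto simp: lless_def cd_lattice_def)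

lemma bounded_lattice_L: "bounded_lattice L"
  using quasi_antichain by (simp add: quasi_antichain_def)

lemma carrier_L_eq: "carrier L = {\<top>\<^bsub>L\<^esub>, \<bottom>\<^bsub>L\<^esub>} \<union> atoms L"
  using quasi_antichain by (simp add: quasi_antichain_def)

lemma L_bottom: "\<bottom>\<^bsub>L\<^esub> \<in> carrier L" "H \<in> carrier L \<Longrightarrow> \<bottom>\<^bsub>L\<^esub> \<subseteq> H"
  and L_top: "\<top>\<^bsub>L\<^esub> \<in> carrier L" "H \<in> carrier L \<Longrightarrow> H \<subseteq> \<top>\<^bsub>L\<^esub>"
proof -
  interpret bounded_lattice L
    by (rule bounded_lattice_L)
  show "\<bottom>\<^bsub>L\<^esub> \<in> carrier L" "\<top>\<^bsub>L\<^esub> \<in> carrier L"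
    by (rule bottom_closed, rule top_closed)
  show "\<bottom>\<^bsub>L\<^esub> \<subseteq> H" "H \<subseteq> \<top>\<^bsub>L\<^esub>" if "H \<in> carrier L"
    using bottom_lower[OF that] top_higher[OF that] by (simp_all add: L_le_iff)
qed

lemma L_center_subset: "H \<in> carrier L \<Longrightarrow> Z \<subseteq> H"
  using center_subset_cd by (simp add: L_carrier_iff)

lemma L_subgroup: "H \<in> carrier L \<Longrightarrow> subgroup H G"
  by (simp add: L_carrier_iff)

lemma atom_L: "H \<in> atoms L \<Longrightarrow> H \<in> carrier L"
  by (simp add: atoms_def)

lemma other_atom:
  obtains K where "K \<in> atoms L" "K \<noteq> H"
proof -
  have "card (atoms L) \<ge> 3"
    using quasi_antichain by (simp add: quasi_antichain_def)
  moreover have "card (atoms L) \<le> card {H}" if "atoms L \<subseteq> {H}"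
    using that by (intro card_mono) auto
  ultimately have "\<not> atoms L \<subseteq> {H}"
    by auto
  then show thesis
    using that by blast
qed

lemma atoms_inter:
  assumes "H \<in> atoms L" "K \<in> atoms L" "H \<noteq> K"
  shows "\<pi> ` H \<inter> \<pi> ` K = {\<one>\<^bsub>V\<^esub>}" and "\<pi> ` H <#>\<^bsub>V\<^esub> \<pi> ` K = carrier V"
  using direct[OF assms] by (simp_all add: internal_direct_product_def carrier_mod_center)

lemma atoms_inter_subset:
  assumes "H \<in> atoms L" "K \<in> atoms L" "H \<noteq> K"
  shows "H \<inter> K \<subseteq> Z"
proof
  fix x assume x: "x \<in> H \<inter> K"
  then have "\<pi> x \<in> \<pi> ` H \<inter> \<pi> ` K"
    by blast
  then have "\<pi> x = \<one>\<^bsub>V\<^esub>"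
    unfolding atoms_inter(1)[OF assms] by simp
  moreover have "x \<in> carrier G"
    using x L_subgroup[OF atom_L[OF assms(1)]] subgroup.subset by blast
  ultimately show "x \<in> Z"
    using \<pi>_eq_one_iff by blast
qed

text \<open>The bottom lies in two distinct atoms, whose intersection is contained in
  \<open>Z\<close> by the direct product condition; and every member of the lattice contains
  \<open>Z\<close>.\<close>

lemma L_bottom_eq: "\<bottom>\<^bsub>L\<^esub> = Z"
proof
  obtain H where H: "H \<in> atoms L"
    using other_atom by blast
  obtain K where K: "K \<in> atoms L" "K \<noteq> H"
    using other_atom by blast
  have "\<bottom>\<^bsub>L\<^esub> \<subseteq> H \<inter> K"
    using L_bottom(2) atom_L H K by blast
  then show "\<bottom>\<^bsub>L\<^esub> \<subseteq> Z"
    using atoms_inter_subset[OF H K(1)] K(2) by blast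
  show "Z \<subseteq> \<bottom>\<^bsub>L\<^esub>"
    using L_center_subset L_bottom(1) .
qed

text \<open>The center, being the bottom, attains the maximum.\<close>

lemma cd_max_eq: "cd_max G = card Z * card (carrier G)"
  using L_bottom(1) by (simp add: L_bottom_eq L_carrier_iff cd_measure_def centralizer_center)

text \<open>\<open>G\<close> has the same measure as its center, so it belongs to the
  lattice.\<close>

lemma L_top_eq: "\<top>\<^bsub>L\<^esub> = carrier G"
proof
  show "\<top>\<^bsub>L\<^esub> \<subseteq> carrier G"
    using L_subgroup[OF L_top(1)] subgroup.subset by blast
  have "carrier G \<in> carrier L"
    by (simp add: L_carrier_iff subgroup_self cd_max_eq cd_measure_def mult.commute flip: center_def)
  then show "carrier G \<subseteq> \<top>\<^bsub>L\<^esub>"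
    by (rule L_top(2))
qed

text \<open>If \<open>G\<close> were an atom it would contain another atom \<open>K\<close>, and
  \<open>K\<close>, lying in the intersection of the two, would equal \<open>Z\<close>. Conversely,
  a quasi-antichain has only atoms besides its top and bottom.\<close>

lemma atoms_L_iff: "H \<in> atoms L \<longleftrightarrow> H \<in> carrier L \<and> H \<noteq> Z \<and> H \<noteq> carrier G"
proof
  assume H: "H \<in> atoms L"
  have neq_Z: "K \<noteq> Z" if "K \<in> atoms L" for K
    using that by (auto simp: atoms_def L_lless_iff L_bottom_eq)
  moreover have "H \<noteq> carrier G"
  proof
    assume eq: "H = carrier G"
    obtain K where K: "K \<in> atoms L" "K \<noteq> H"
      using other_atom by blast
    have "K \<subseteq> H"
      using eq L_subgroup[OF atom_L[OF K(1)]] subgroup.subset by blast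
    then have "K \<subseteq> Z"
      using atoms_inter_subset[OF H K(1)] K(2) by blast
    then show False
      using L_center_subset[OF atom_L[OF K(1)]] neq_Z[OF K(1)] by blast
  qed
  ultimately show "H \<in> carrier L \<and> H \<noteq> Z \<and> H \<noteq> carrier G"
    using H atom_L by blast
next
  assume "H \<in> carrier L \<and> H \<noteq> Z \<and> H \<noteq> carrier G"
  then show "H \<in> atoms L"
    using carrier_L_eq by (auto simp: L_bottom_eq L_top_eq)
qed

lemma card_carrier_G: "card (carrier G) = card Z * card (carrier V)"
  using card_subgroup[OF subgroup_self Z.subset] by (simp add: carrier_V)

lemma card_Z_pos: "card Z > 0"
  using Z.one_closed finite_subset[OF Z.subset finite_carrier] card_gt_0_iff[of Z] by blast

lemma cd_max_eq': "cd_max G = (card Z)\<^sup>2 * card (carrier V)"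
  by (simp add: cd_max_eq card_carrier_G power2_eq_square)

text \<open>Under the correspondence of subgroups above \<open>Z\<close> with subgroups of
  \<open>V\<close>, maximal measure becomes the cardinality equation once \<open>|Z|^2\<close> is
  cancelled.\<close>

lemma cd_atoms_eq: "form.cd_atoms = (\<lambda>H. \<pi> ` H) ` atoms L"
proof -
  have iff: "\<pi> ` H \<in> form.cd_atoms \<longleftrightarrow> H \<in> atoms L" if H: "subgroup H G" "Z \<subseteq> H" for H
  proof -
    have HG: "H \<subseteq> carrier G"
      using subgroup.subset[OF H(1)] .
    have "\<pi> ` H = {\<one>\<^bsub>V\<^esub>} \<longleftrightarrow> H = Z"
    proof -
      have "\<pi> ` H = {\<one>\<^bsub>V\<^esub>} \<longleftrightarrow> (\<forall>x\<in>H. \<pi> x = \<one>\<^bsub>V\<^esub>)"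
        using subgroup.one_closed[OF H(1)] by blast
      also have "\<dots> \<longleftrightarrow> H \<subseteq> Z"
        using \<pi>_eq_one_iff HG by blast
      finally show ?thesis
        using H(2) by blast
    qed
    moreover have "\<pi> ` H = carrier V \<longleftrightarrow> H = carrier G"
      unfolding carrier_V using subset_image_\<pi>_iff[OF H, of "carrier G"] HG by blast
    moreover have "card (\<pi> ` H) * card (form.perp (\<pi> ` H)) = card (carrier V) \<longleftrightarrow> cd_measure G H = cd_max G"
      using card_Z_pos by (simp add: cd_measure_eq_perp[OF H] cd_max_eq')
    ultimately show ?thesis
      using H subgroup_image_\<pi> unfolding form.cd_atoms_def atoms_L_iff L_carrier_iff by blast
  qed
  show ?thesis
  proof (intro equalityI subsetI)
    fix U assume U: "U \<in> form.cd_atoms"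
    then have "subgroup U V"
      by (simp add: form.cd_atoms_def)
    then obtain H where "subgroup H G" "Z \<subseteq> H" "U = \<pi> ` H"
      by (rule subgroup_V_cases)
    with U iff show "U \<in> (\<lambda>H. \<pi> ` H) ` atoms L"
      by blast
  next
    fix U assume "U \<in> (\<lambda>H. \<pi> ` H) ` atoms L"
    then obtain H where "H \<in> atoms L" "U = \<pi> ` H"
      by blast
    with iff[of H] show "U \<in> form.cd_atoms"
      using L_subgroup L_center_subset atom_L by blast
  qed
qed

lemma inj_on_image_atoms: "inj_on (\<lambda>H. \<pi> ` H) (atoms L)"
proof (rule inj_onI)
  fix H K assume H: "H \<in> atoms L" and K: "K \<in> atoms L" and eq: "\<pi> ` H = \<pi> ` K"
  note HL = atom_L[OF H] and KL = atom_L[OF K]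
  note HG = subgroup.subset[OF L_subgroup[OF HL]] and KG = subgroup.subset[OF L_subgroup[OF KL]]
  have "H \<subseteq> K"
    using subset_image_\<pi>_iff[OF L_subgroup[OF KL] L_center_subset[OF KL] HG] eq by simp
  moreover have "K \<subseteq> H"
    using subset_image_\<pi>_iff[OF L_subgroup[OF HL] L_center_subset[OF HL] KG] eq by simp
  ultimately show "H = K" ..
qed

text \<open>The bound on the form is maximality of \<open>cd_max G\<close>; complementarity of the
  atoms comes from the direct products, and their equal order from the isomorphisms in (P2).\<close>

sublocale form: quasi_antichain_form V "G\<lparr>carrier := Z\<rparr>" \<kappa>
proof (intro quasi_antichain_form.intro quasi_antichain_form_axioms.intro \<kappa>_alternating_form)
  fix U assume "subgroup U V"
  then obtain H where H: "subgroup H G" "Z \<subseteq> H" "U = \<pi> ` H"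
    by (rule subgroup_V_cases)
  have "(card Z)\<^sup>2 * (card U * card (form.perp U)) \<le> (card Z)\<^sup>2 * card (carrier V)"
    using cd_measure_le[OF H(1)] unfolding cd_measure_eq_perp[OF H(1,2)] cd_max_eq' H(3) .
  then show "card U * card (form.perp U) \<le> card (carrier V)"
    using card_Z_pos by simp
next
  fix U U' assume "U \<in> form.cd_atoms" "U' \<in> form.cd_atoms"
  then obtain H K where HK: "H \<in> atoms L" "K \<in> atoms L" "U = \<pi> ` H" "U' = \<pi> ` K"
    unfolding cd_atoms_eq by blast
  show "U \<inter> U' = {\<one>\<^bsub>V\<^esub>}" "U <#>\<^bsub>V\<^esub> U' = carrier V" if "U \<noteq> U'"
    using atoms_inter[OF HK(1,2)] HK(3,4) that by blast+
  show "card U = card U'"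
  proof (cases "H = K")
    case False
    then show ?thesis
      using iso_same_card[OF isomorphic[OF HK(1,2)]] HK(3,4) by (simp add: carrier_mod_center)
  qed (use HK in simp)
qed

lemma isotropic_iff:
  assumes "H \<in> atoms L"
  shows "\<pi> ` H \<subseteq> form.perp (\<pi> ` H) \<longleftrightarrow> comm_group (G\<lparr>carrier := H\<rparr>)"
proof -
  have H: "subgroup H G" "H \<subseteq> carrier G"
    using L_subgroup[OF atom_L[OF assms]] subgroup.subset by blast+
  show ?thesis
    unfolding perp_image[OF H(2)] comm_group_subgroup_iff[OF H(1)]
    using H(2) by (intro subset_image_\<pi>_iff subgroup_centralizer center_subset_centralizer)
qed

lemma isotropic_atoms_image:
  "{U \<in> form.cd_atoms. U \<subseteq> form.perp U} = (\<lambda>H. \<pi> ` H) ` {H \<in> atoms L. comm_group (G\<lparr>carrier := H\<rparr>)}"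
  unfolding cd_atoms_eq using isotropic_iff by blast

end

hide_const (open) Polynomial.order

theorem theorem3:
  fixes p w t :: nat and G :: "('a, 'm) monoid_scheme" and M :: "nat \<Rightarrow> 'a set"
  assumes "Factorial_Ring.prime p"
    and "finite_p_group p G"
    and "quasi_antichain (cd_lattice G) w"
    and "bij_betw M {1..w} (atoms (cd_lattice G))"
    and "P1 p G" and "P2 G w M" and "P3 p G w M"
    and "t = card {A \<in> atoms (cd_lattice G). comm_group (G\<lparr>carrier := A\<rparr>)}"
    and "t > 2"
  shows "\<exists>a b :: nat. a > 0 \<and> b > 0 \<and> w = p ^ a + 1 \<and> t = p ^ b + 1 \<and>
           (a = b \<or> a = 2 * b) \<and>
           (\<forall>n. order (G Mod center G) = p ^ (2 * n) \<longrightarrow> a dvd n)"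
proof -
  let ?L = "cd_lattice G"
  \<comment> \<open>The bijection \<open>M\<close> turns (P2) for indices into a statement about
    arbitrary distinct atoms.\<close>
  have P2: "mod_center G H \<cong> mod_center G K \<and> internal_direct_product (G Mod center G)
      (carrier (mod_center G H)) (carrier (mod_center G K))"
    if "H \<in> atoms ?L" "K \<in> atoms ?L" "H \<noteq> K" for H K
  proof -
    have "H \<in> M ` {1..w}" "K \<in> M ` {1..w}"
      using that(1,2) unfolding bij_betw_imp_surj_on[OF assms(4)] .
    then obtain i j where ij: "i \<in> {1..w}" "j \<in> {1..w}" "H = M i" "K = M j"
      by blast
    then have "i \<noteq> j"
      using that(3) by blast
    then show ?thesis
      using assms(6)[unfolded P2_def, rule_format, OF ij(1,2)] unfolding ij(3,4) by simp
  qed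
  interpret cd_quasi_antichain_group G w
  proof (intro cd_quasi_antichain_group.intro class2_group.intro class2_group_axioms.intro
      cd_quasi_antichain_group_axioms.intro)
    show "group G" "finite (carrier G)"
      using assms(2) by (auto simp: finite_p_group_def)
    show "comm_group (G Mod center G)"
      using assms(5) by (simp add: P1_def elementary_abelian_def)
  qed (use assms(3) P2 in blast)+
  let ?I = "{U \<in> form.cd_atoms. U \<subseteq> form.perp U}"
  have card_I: "card ?I = t"
    unfolding isotropic_atoms_image assms(8)
    by (intro card_image inj_on_subset[OF inj_on_image_atoms]) auto
  then have "3 \<le> card ?I"
    using assms(9) by linarith
  \<comment> \<open>The condition \<open>t > 2\<close> provides the three isotropic atoms that serve
    as the frame.\<close>
  then obtain T where T: "T \<subseteq> ?I" "card T = 3" "finite T"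
    by (rule obtain_subset_with_card_n)
  obtain A B C where "T = {A, B, C}" "A \<noteq> B" "B \<noteq> C" "A \<noteq> C"
    using T(2) unfolding card_3_iff by blast
  with T(1) have ABC: "A \<in> ?I" "B \<in> ?I" "C \<in> ?I" "A \<noteq> B" "B \<noteq> C" "A \<noteq> C"
    by simp_all
  interpret isotropic_frame V "G\<lparr>carrier := Z\<rparr>" \<kappa> A B C
    using ABC by unfold_locales simp_all
  have exp: "S [^]\<^bsub>G Mod center G\<^esub> p = \<one>\<^bsub>G Mod center G\<^esub>" if "S \<in> carrier (G Mod center G)" for S
    using assms(5) that by (simp add: P1_def elementary_abelian_def)
  obtain a b k where abk: "a > 0" "b > 0" "card form.cd_atoms = p ^ a + 1"
      "card ?I = p ^ b + 1" "a = b \<or> a = 2 * b" "card (carrier V) = p ^ (2 * (a * k))"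
    using assms(1) exp by (rule card_cd_atoms)
  have "card form.cd_atoms = w"
    unfolding cd_atoms_eq card_image[OF inj_on_image_atoms]
    using assms(3) by (simp add: quasi_antichain_def)
  moreover have "a dvd n" if "order (G Mod center G) = p ^ (2 * n)" for n
  proof -
    \<comment> \<open>The two expressions for \<open>|G/Z(G)|\<close> can be compared by exponents
      because \<open>p > 1\<close>.\<close>
    have "p ^ (2 * n) = p ^ (2 * (a * k))"
      using that abk(6) by (simp add: Coset.order_def)
    then have "n = a * k"
      using prime_gt_1_nat[OF assms(1)] by (simp add: power_inject_exp)
    then show ?thesis
      by simp
  qed
  ultimately show ?thesis
    using abk card_I by auto
qed

end
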